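(* Let $T>0$, $u_0\in H^1(\mathbb{R}^d)$, and let $q\in L^\infty(\mathbb{R}^d)$ be non-negative. Consider the Cauchy problem $$u_t(t,x)-\Delta u(t,x)+q(x)u(t,x)=0,\quad(t,x)\in[0,T]\times\mathbb{R}^d,\qquad u(0,x)=u_0(x),$$ and let $u$ be its classical solution. Let $(u_\varepsilon)_\varepsilon$ be a very weak solution of this problem. Then, for any regularising families $(q_\varepsilon)_\varepsilon$ and $(u_{0,\varepsilon})_\varepsilon$ of $q$ and $u_0$, the net $(u_\varepsilon)_\varepsilon$ converges in $L^2$ as $\varepsilon\to0$ to the classical solution, i.e. $\Vert u_\varepsilon(t,\cdot)-u(t,\cdot)\Vert_{L^2}\to0$ as $\varepsilon\to 0$ for $t\in[0,T]$.
   Context: The classical solution is the unique solution $u\in C^1([0,T];L^2(\mathbb{R}^d))\cap C([0,T];H^1(\mathbb{R}^d))$ of the Cauchy problem. Regularising families: $q_\varepsilon=q\ast\psi_\varepsilon$, $u_{0,\varepsilon}=u_0\ast\psi_\varepsilon$, where $\psi\in C_0^\infty(\mathbb{R}^d)$, $\psi\ge0$, $\int\psi=1$ (Friedrichs mollifier), $\psi_\varepsilon(x)=\omega(\varepsilon)^{-d}\psi(x/\omega(\varepsilon))$ for $\varepsilon\in(0,1]$, and $\omega(\varepsilon)$ is a positive function with $\omega(\varepsilon)\to0$ as $\varepsilon\to0$. Moderateness: for a Banach space $X$, a net $(f_\varepsilon)_{\varepsilon\in(0,1]}$ in $X$ is $X$-moderate if there exist $N\in\mathbb{N}_0$, $c>0$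 with $\Vert f_\varepsilon\Vert_X\le c\,\omega(\varepsilon)^{-N}$ for all $\varepsilon$. Very weak solution: the net $(u_\varepsilon)_\varepsilon$ is a very weak solution if, for an $L^\infty$-moderate regularisation $(q_\varepsilon)_\varepsilon$ of $q$ with $q_\varepsilon\ge0$ and an $H^1$-moderate regularisation $(u_{0,\varepsilon})_\varepsilon$ of $u_0$, $u_\varepsilon$ solves $\partial_t u_\varepsilon-\Delta u_\varepsilon+q_\varepsilon u_\varepsilon=0$ with $u_\varepsilon(0,\cdot)=u_{0,\varepsilon}$ for all $\varepsilon\in(0,1]$, and $(u_\varepsilon)_\varepsilon$ is $C([0,T];H^1(\mathbb{R}^d))$-moderate. *)

theory Defs
  imports "HOL-Analysis.Analysis" "HOL-Probability.Essential_Supremum"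
begin

text \<open>
  \<open>\<real>\<^sup>d\<close> is an arbitrary type \<open>'a :: euclidean_space\<close> with \<open>d = DIM('a)\<close>. Solutions are
  complex-valued, potentials real-valued. Elements of the function spaces are Lebesgue
  measurable representatives, so identities between them are stated almost everywhere.
\<close>

section \<open>Test functions\<close>

definition partial :: "'a::euclidean_space \<Rightarrow> ('a \<Rightarrow> real) \<Rightarrow> 'a \<Rightarrow> real" where
  "partial b f = (\<lambda>x. frechet_derivative f (at x) b)"

text \<open>
  All iterated partial derivatives are (totally) differentiable everywhere, hence also
  continuous; this is \<open>C\<^sup>\<infinity>\<close>.
\<close>
definition smooth :: "('a::euclidean_space \<Rightarrow> real) \<Rightarrow> bool" where
  "smooth f \<longleftrightarrow> (\<forall>bs. set bs \<subseteq> Basis \<longrightarrow> (\<forall>x. foldr partial bs f differentiable (at x)))"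

definition test_function :: "('a::euclidean_space \<Rightarrow> real) \<Rightarrow> bool" where
  "test_function \<phi> \<longleftrightarrow> smooth \<phi> \<and> compact (closure {x. \<phi> x \<noteq> 0})"

definition laplacian :: "('a::euclidean_space \<Rightarrow> real) \<Rightarrow> 'a \<Rightarrow> real" where
  "laplacian \<phi> x = (\<Sum>b\<in>Basis. partial b (partial b \<phi>) x)"

section \<open>Function spaces on \<open>\<real>\<^sup>d\<close>\<close>

definition L2 :: "('a::euclidean_space \<Rightarrow> complex) set" where
  "L2 = {f \<in> borel_measurable lebesgue. integrable lebesgue (\<lambda>x. (norm (f x))\<^sup>2)}"

definition L2_norm :: "('a::euclidean_space \<Rightarrow> complex) \<Rightarrow> real" where
  "L2_norm f = sqrt (LINT x|lebesgue. (norm (f x))\<^sup>2)"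

definition Linf :: "('a::euclidean_space \<Rightarrow> real) set" where
  "Linf = {f \<in> borel_measurable lebesgue. esssup lebesgue (\<lambda>x. ereal \<bar>f x\<bar>) < \<infinity>}"

definition Linf_norm :: "('a::euclidean_space \<Rightarrow> real) \<Rightarrow> real" where
  "Linf_norm f = real_of_ereal (esssup lebesgue (\<lambda>x. ereal \<bar>f x\<bar>))"

text \<open>Distributional derivatives of \<open>L\<^sup>2\<close> functions that are again in \<open>L\<^sup>2\<close>.\<close>

definition has_weak_partial ::
  "'a::euclidean_space \<Rightarrow> ('a \<Rightarrow> complex) \<Rightarrow> ('a \<Rightarrow> complex) \<Rightarrow> bool" where
  "has_weak_partial b f g \<longleftrightarrow> f \<in> L2 \<and> g \<in> L2 \<and>
     (\<forall>\<phi>. test_function \<phi> \<longrightarrow>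
        (LINT x|lebesgue. partial b \<phi> x *\<^sub>R f x) = - (LINT x|lebesgue. \<phi> x *\<^sub>R g x))"

definition has_weak_laplacian ::
  "('a::euclidean_space \<Rightarrow> complex) \<Rightarrow> ('a \<Rightarrow> complex) \<Rightarrow> bool" where
  "has_weak_laplacian f g \<longleftrightarrow> f \<in> L2 \<and> g \<in> L2 \<and>
     (\<forall>\<phi>. test_function \<phi> \<longrightarrow>
        (LINT x|lebesgue. laplacian \<phi> x *\<^sub>R f x) = (LINT x|lebesgue. \<phi> x *\<^sub>R g x))"

text \<open>Determined up to a null set whenever a weak derivative exists.\<close>
definition weak_partial :: "'a::euclidean_space \<Rightarrow> ('a \<Rightarrow> complex) \<Rightarrow> 'a \<Rightarrow> complex" where
  "weak_partial b f = (SOME g. has_weak_partial b f g)"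

definition H1 :: "('a::euclidean_space \<Rightarrow> complex) set" where
  "H1 = {f \<in> L2. \<forall>b\<in>Basis. \<exists>g. has_weak_partial b f g}"

definition H1_norm :: "('a::euclidean_space \<Rightarrow> complex) \<Rightarrow> real" where
  "H1_norm f = sqrt ((L2_norm f)\<^sup>2 + (\<Sum>b\<in>Basis. (L2_norm (weak_partial b f))\<^sup>2))"

section \<open>Functions of time with values in a function space\<close>

definition C_into ::
  "real \<Rightarrow> ('a \<Rightarrow> complex) set \<Rightarrow> (('a \<Rightarrow> complex) \<Rightarrow> real) \<Rightarrow> (real \<Rightarrow> 'a \<Rightarrow> complex) set" where
  "C_into T X nrm = {u. \<forall>t\<in>{0..T}. u t \<in> X \<and>
     ((\<lambda>s. nrm (\<lambda>x. u s x - u t x)) \<longlongrightarrow> 0) (at t within {0..T})}"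

definition C_norm ::
  "real \<Rightarrow> (('a \<Rightarrow> complex) \<Rightarrow> real) \<Rightarrow> (real \<Rightarrow> 'a \<Rightarrow> complex) \<Rightarrow> real" where
  "C_norm T nrm u = (SUP t\<in>{0..T}. nrm (u t))"

text \<open>\<open>u \<in> C\<^sup>1([0,T]; L\<^sup>2)\<close> with derivative \<open>u'\<close>, one-sided at the end points.\<close>
definition has_C1_L2_deriv ::
  "real \<Rightarrow> (real \<Rightarrow> 'a::euclidean_space \<Rightarrow> complex) \<Rightarrow> (real \<Rightarrow> 'a \<Rightarrow> complex) \<Rightarrow> bool" where
  "has_C1_L2_deriv T u u' \<longleftrightarrow> u \<in> C_into T L2 L2_norm \<and> u' \<in> C_into T L2 L2_norm \<and>
     (\<forall>t\<in>{0..T}. ((\<lambda>s. L2_norm (\<lambda>x. (u s x - u t x) /\<^sub>R (s - t) - u' t x)) \<longlongrightarrow> 0)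
                    (at t within {0..T}))"

section \<open>The Cauchy problem\<close>

text \<open>
  For \<open>u \<in> C\<^sup>1([0,T]; L\<^sup>2) \<inter> C([0,T]; H\<^sup>1)\<close> the equation forces the distribution \<open>\<Delta>u(t)\<close> to be
  the \<open>L\<^sup>2\<close> function \<open>u\<^sub>t(t) + q u(t)\<close>, for every \<open>t\<close> in \<open>[0,T]\<close>.
\<close>
definition classical_solution ::
  "real \<Rightarrow> ('a::euclidean_space \<Rightarrow> real) \<Rightarrow> ('a \<Rightarrow> complex) \<Rightarrow> (real \<Rightarrow> 'a \<Rightarrow> complex) \<Rightarrow> bool" where
  "classical_solution T q u0 u \<longleftrightarrow>
     u \<in> C_into T H1 H1_norm \<and>
     (\<exists>u'. has_C1_L2_deriv T u u' \<and>
        (\<forall>t\<in>{0..T}. \<exists>Lu. has_weak_laplacian (u t) Lu \<and>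
           (AE x in lebesgue. u' t x - Lu x + q x *\<^sub>R u t x = 0))) \<and>
     (AE x in lebesgue. u 0 x = u0 x)"

section \<open>Regularisation and very weak solutions\<close>

definition friedrichs_mollifier :: "('a::euclidean_space \<Rightarrow> real) \<Rightarrow> bool" where
  "friedrichs_mollifier \<psi> \<longleftrightarrow>
     test_function \<psi> \<and> (\<forall>x. \<psi> x \<ge> 0) \<and> (LINT x|lebesgue. \<psi> x) = 1"

definition scaled :: "('a::euclidean_space \<Rightarrow> real) \<Rightarrow> real \<Rightarrow> 'a \<Rightarrow> real" where
  "scaled \<psi> r x = \<psi> (x /\<^sub>R r) / r ^ DIM('a)"

definition convolve ::
  "('a::euclidean_space \<Rightarrow> 'b::{banach, second_countable_topology}) \<Rightarrow> ('a \<Rightarrow> real) \<Rightarrow> 'a \<Rightarrow> 'b" where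
  "convolve f \<psi> x = (LINT y|lebesgue. \<psi> (x - y) *\<^sub>R f y)"

definition regularising_scale :: "(real \<Rightarrow> real) \<Rightarrow> bool" where
  "regularising_scale \<omega> \<longleftrightarrow> (\<forall>\<epsilon>\<in>{0<..1}. \<omega> \<epsilon> > 0) \<and> (\<omega> \<longlongrightarrow> 0) (at_right 0)"

definition regularising_families ::
  "(real \<Rightarrow> real) \<Rightarrow> ('a::euclidean_space \<Rightarrow> real) \<Rightarrow> ('a \<Rightarrow> complex) \<Rightarrow>
   (real \<Rightarrow> 'a \<Rightarrow> real) \<Rightarrow> (real \<Rightarrow> 'a \<Rightarrow> complex) \<Rightarrow> bool" where
  "regularising_families \<omega> q u0 q\<epsilon> u0\<epsilon> \<longleftrightarrow>
     (\<exists>\<psi>. friedrichs_mollifier \<psi> \<and>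
        (\<forall>\<epsilon>\<in>{0<..1}. q\<epsilon> \<epsilon> = convolve q (scaled \<psi> (\<omega> \<epsilon>)) \<and>
                        u0\<epsilon> \<epsilon> = convolve u0 (scaled \<psi> (\<omega> \<epsilon>))))"

definition moderate ::
  "(real \<Rightarrow> real) \<Rightarrow> 'x set \<Rightarrow> ('x \<Rightarrow> real) \<Rightarrow> (real \<Rightarrow> 'x) \<Rightarrow> bool" where
  "moderate \<omega> X nrm f \<longleftrightarrow> (\<forall>\<epsilon>\<in>{0<..1}. f \<epsilon> \<in> X) \<and>
     (\<exists>(N::nat) c. c > 0 \<and> (\<forall>\<epsilon>\<in>{0<..1}. nrm (f \<epsilon>) \<le> c / \<omega> \<epsilon> ^ N))"

text \<open>The net \<open>u\<epsilon>\<close> is a very weak solution, obtained from the families \<open>q\<epsilon>\<close> and \<open>u0\<epsilon>\<close>.\<close>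
definition very_weak_solution ::
  "real \<Rightarrow> (real \<Rightarrow> real) \<Rightarrow> ('a::euclidean_space \<Rightarrow> real) \<Rightarrow> ('a \<Rightarrow> complex) \<Rightarrow>
   (real \<Rightarrow> 'a \<Rightarrow> real) \<Rightarrow> (real \<Rightarrow> 'a \<Rightarrow> complex) \<Rightarrow> (real \<Rightarrow> real \<Rightarrow> 'a \<Rightarrow> complex) \<Rightarrow> bool" where
  "very_weak_solution T \<omega> q u0 q\<epsilon> u0\<epsilon> u\<epsilon> \<longleftrightarrow>
     regularising_families \<omega> q u0 q\<epsilon> u0\<epsilon> \<and>
     moderate \<omega> Linf Linf_norm q\<epsilon> \<and>
     (\<forall>\<epsilon>\<in>{0<..1}. AE x in lebesgue. q\<epsilon> \<epsilon> x \<ge> 0) \<and>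
     moderate \<omega> H1 H1_norm u0\<epsilon> \<and>
     (\<forall>\<epsilon>\<in>{0<..1}. classical_solution T (q\<epsilon> \<epsilon>) (u0\<epsilon> \<epsilon>) (u\<epsilon> \<epsilon>)) \<and>
     moderate \<omega> (C_into T H1 H1_norm) (C_norm T H1_norm) u\<epsilon>"

end

theory Submission
  imports Defs
begin

text \<open>
  The difference \<open>v = u\<^sub>\<epsilon> - u\<close> solves \<open>v\<^sub>t - \<Delta>v + q\<^sub>\<epsilon> v = -(q\<^sub>\<epsilon> - q) u\<close>. Testing with \<open>v\<close> and using
  \<open>\<langle>v, \<Delta>v\<rangle> \<le> 0\<close> and \<open>q\<^sub>\<epsilon> \<ge> 0\<close> gives \<open>d/dt \<parallel>v\<parallel>\<^sup>2 \<le> \<parallel>v\<parallel>\<^sup>2 + \<delta>\<^sup>2\<close>, where \<open>\<delta>\<close> bounds \<open>\<parallel>(q\<^sub>\<epsilon> - q) u(s)\<parallel>\<close>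
  on \<open>[0,T]\<close>; hence \<open>\<parallel>v(t)\<parallel>\<^sup>2 \<le> exp T (\<parallel>v(0)\<parallel>\<^sup>2 + T \<delta>\<^sup>2)\<close>.

  Both \<open>\<parallel>v(0)\<parallel>\<close> and \<open>\<delta>\<close> vanish in the limit by continuity of translations in \<open>L\<^sup>2\<close>: by Jensen's
  inequality it suffices to control \<open>f(\<cdot> - h) - f\<close>, respectively
  \<open>(q(\<cdot> - h) - q) u = q(\<cdot> - h) (u - u(\<cdot> - h)) + ((q u)(\<cdot> - h) - q u)\<close>, for small \<open>h\<close>. Uniformity in \<open>s\<close>
  follows since \<open>u([0,T])\<close> is compact in \<open>L\<^sup>2\<close> and the \<open>q\<^sub>\<epsilon>\<close> are uniformly bounded.
\<close>

section \<open>The real Hilbert space structure of \<open>L\<^sup>2\<close>\<close>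

text \<open>The remainder is attached to the classical solution and the damping term to the
  regularised potential because \<open>q\<epsilon> \<epsilon>\<close> need not approach
  \<open>q\<close> in the supremum norm. Only (q_eps - q) f tends to 0 in L2 for each fixed f, so
  the factor beside the difference must not vary with \<epsilon>. The sign of the Laplacian term is
  not immediate: \<open>has_weak_laplacian\<close> pairs with test functions only, and v(t) is not
  one. It is obtained by mollifying, with the kernel \<psi> that comes with the very weak solution,
  so no bump function has to be constructed. Squared norms are estimated because the norm itself
  need not be differentiable where v vanishes. The Young inequality 2 |v| \<delta> \<le> |v|^2 +
  \<delta>^2 makes the estimate linear in |v|^2 with rate 1, which is the origin of exp T. On
  complex numbers \<open>\<bullet>\<close> is the real part of the Hermitian product, so
  \<open>L2_inner\<close> is exactly the pairing in d/dt |v|^2 = 2 Re (v, v'). Elements of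
  \<open>L2\<close> are functions, not classes, whence the almost-everywhere congruence rules and
  the Borel representatives.\<close>

definition L2_inner :: "('a::euclidean_space \<Rightarrow> complex) \<Rightarrow> ('a \<Rightarrow> complex) \<Rightarrow> real" where
  "L2_inner f g = (LINT x|lebesgue. f x \<bullet> g x)"

lemma L2_measurable: "f \<in> L2 \<Longrightarrow> f \<in> borel_measurable lebesgue"
  by (simp add: L2_def)

lemma L2_inner_integrable:
  assumes "f \<in> L2" "g \<in> L2"
  shows "integrable lebesgue (\<lambda>x. f x \<bullet> g x)"
proof -
  have [measurable]: "f \<in> borel_measurable lebesgue" "g \<in> borel_measurable lebesgue"
    using assms by (auto simp: L2_def)
  have "integrable lebesgue (\<lambda>x. (norm (f x))\<^sup>2 + (norm (g x))\<^sup>2)"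
    using assms by (auto simp: L2_def)
  then show ?thesis
  proof (rule Bochner_Integration.integrable_bound)
    show "AE x in lebesgue. norm (f x \<bullet> g x) \<le> norm ((norm (f x))\<^sup>2 + (norm (g x))\<^sup>2)"
    proof (rule AE_I2)
      fix x
      have "\<bar>f x \<bullet> g x\<bar> \<le> norm (f x) * norm (g x)" by (rule Cauchy_Schwarz_ineq2)
      also have "\<dots> \<le> (norm (f x))\<^sup>2 + (norm (g x))\<^sup>2"
        using sum_squares_bound[of "norm (f x)" "norm (g x)"] mult_nonneg_nonneg[OF norm_ge_zero norm_ge_zero, of "f x" "g x"]
        by linarith
      finally show "norm (f x \<bullet> g x) \<le> norm ((norm (f x))\<^sup>2 + (norm (g x))\<^sup>2)" by simp
    qed
  qed measurable
qed

lemma L2_norm_square: "(L2_norm f)\<^sup>2 = L2_inner f f"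
  by (simp add: L2_norm_def L2_inner_def dot_square_norm)

lemma L2_norm_nonneg [simp]: "0 \<le> L2_norm f"
  by (simp add: L2_norm_def)

lemma L2_bounded_mult:
  fixes q :: "'a::euclidean_space \<Rightarrow> real"
  assumes "f \<in> L2" "q \<in> borel_measurable lebesgue" "AE x in lebesgue. \<bar>q x\<bar> \<le> C"
  shows "(\<lambda>x. q x *\<^sub>R f x) \<in> L2"
proof -
  have [measurable]: "f \<in> borel_measurable lebesgue" "q \<in> borel_measurable lebesgue"
    using assms by (auto simp: L2_def)
  have "integrable lebesgue (\<lambda>x. C\<^sup>2 * (norm (f x))\<^sup>2)"
    using assms by (auto simp: L2_def)
  then have "integrable lebesgue (\<lambda>x. (norm (q x *\<^sub>R f x))\<^sup>2)"
  proof (rule Bochner_Integration.integrable_bound)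
    show "AE x in lebesgue. norm ((norm (q x *\<^sub>R f x))\<^sup>2) \<le> norm (C\<^sup>2 * (norm (f x))\<^sup>2)"
      using assms(3)
    proof eventually_elim
      case (elim x)
      then have "\<bar>q x\<bar>\<^sup>2 \<le> C\<^sup>2" by (intro power_mono) auto
      then show ?case by (simp add: power_mult_distrib mult_right_mono)
    qed
  qed measurable
  then show ?thesis by (simp add: L2_def)
qed

lemma L2_scaleR: "f \<in> L2 \<Longrightarrow> (\<lambda>x. c *\<^sub>R f x) \<in> L2"
  by (rule L2_bounded_mult[where C = "\<bar>c\<bar>"]) auto

lemma L2_add:
  assumes "f \<in> L2" "g \<in> L2"
  shows "(\<lambda>x. f x + g x) \<in> L2"
proof -
  have [measurable]: "f \<in> borel_measurable lebesgue" "g \<in> borel_measurable lebesgue"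
    using assms by (auto simp: L2_def)
  have "integrable lebesgue (\<lambda>x. (norm (f x))\<^sup>2 + 2 * (f x \<bullet> g x) + (norm (g x))\<^sup>2)"
    using assms L2_inner_integrable[OF assms] by (auto simp: L2_def)
  then show ?thesis
    by (simp add: L2_def power2_norm_eq_inner inner_add inner_commute algebra_simps)
qed

lemma L2_diff: "f \<in> L2 \<Longrightarrow> g \<in> L2 \<Longrightarrow> (\<lambda>x. f x - g x) \<in> L2"
  using L2_add[of f "\<lambda>x. (-1) *\<^sub>R g x"] L2_scaleR[of g "-1"] by simp

lemma L2_inner_commute: "L2_inner f g = L2_inner g f"
  by (simp add: L2_inner_def inner_commute)

lemma L2_inner_add_right:
  "f \<in> L2 \<Longrightarrow> g \<in> L2 \<Longrightarrow> h \<in> L2 \<Longrightarrow> L2_inner f (\<lambda>x. g x + h x) = L2_inner f g + L2_inner f h"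
  by (simp add: L2_inner_def inner_add_right L2_inner_integrable)

lemma L2_inner_diff_right:
  "f \<in> L2 \<Longrightarrow> g \<in> L2 \<Longrightarrow> h \<in> L2 \<Longrightarrow> L2_inner f (\<lambda>x. g x - h x) = L2_inner f g - L2_inner f h"
  by (simp add: L2_inner_def inner_diff_right L2_inner_integrable)

lemma L2_inner_scaleR_right: "L2_inner f (\<lambda>x. c *\<^sub>R g x) = c * L2_inner f g"
  by (simp add: L2_inner_def)

lemma L2_norm_scaleR: "L2_norm (\<lambda>x. c *\<^sub>R f x) = \<bar>c\<bar> * L2_norm f"
  by (simp add: L2_norm_def power_mult_distrib real_sqrt_mult)

lemma L2_norm_minus_commute: "L2_norm (\<lambda>x. f x - g x) = L2_norm (\<lambda>x. g x - f x)"
  by (simp add: L2_norm_def norm_minus_commute)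

text \<open>Discriminant argument: the polynomial a + 2 t b + t^2 c is the squared norm of f + t g,
  hence nonnegative for every real t.\<close>

lemma L2_inner_bound:
  assumes "f \<in> L2" "g \<in> L2"
  shows "\<bar>L2_inner f g\<bar> \<le> L2_norm f * L2_norm g"
proof -
  define a b c where "a = L2_inner f f" and "b = L2_inner f g" and "c = L2_inner g g"
  have quad: "0 \<le> a + 2 * t * b + t\<^sup>2 * c" for t
  proof -
    have h: "(\<lambda>x. t *\<^sub>R g x) \<in> L2" "(\<lambda>x. f x + t *\<^sub>R g x) \<in> L2"
      using assms by (auto intro!: L2_add L2_scaleR)
    have "0 \<le> (L2_norm (\<lambda>x. f x + t *\<^sub>R g x))\<^sup>2" by simp
    also have "\<dots> = L2_inner (\<lambda>x. f x + t *\<^sub>R g x) f + L2_inner (\<lambda>x. f x + t *\<^sub>R g x) (\<lambda>x. t *\<^sub>R g x)"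
      unfolding L2_norm_square using assms h by (subst L2_inner_add_right) auto
    also have "\<dots> = L2_inner f (\<lambda>x. f x + t *\<^sub>R g x) + t * L2_inner g (\<lambda>x. f x + t *\<^sub>R g x)"
      by (simp add: L2_inner_scaleR_right L2_inner_commute)
    also have "\<dots> = a + 2 * t * b + t\<^sup>2 * c"
      using assms h
      by (simp add: L2_inner_add_right L2_inner_scaleR_right a_def b_def c_def L2_inner_commute[of g f]
          algebra_simps power2_eq_square)
    finally show ?thesis .
  qed
  have c0: "c \<ge> 0" "a \<ge> 0" by (simp_all add: c_def a_def flip: L2_norm_square)
  have "b\<^sup>2 \<le> a * c"
  proof (cases "c = 0")
    case True
    have "b = 0"
    proof (rule ccontr)
      assume "b \<noteq> 0"
      \<comment> \<open>With c = 0 the polynomial is affine in t, and at this t its value is a - (a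
        + 1) = -1.\<close>
      then show False using quad[of "- (a + 1) / (2 * b)"] True by (simp add: field_simps)
    qed
    then show ?thesis using c0 by simp
  next
    case False
    \<comment> \<open>t = - b / c is the minimiser; the factor c clears the denominator.\<close>
    then have "0 \<le> c * (a + 2 * (- b / c) * b + (- b / c)\<^sup>2 * c)"
      using quad[of "- b / c"] c0 by (intro mult_nonneg_nonneg) auto
    also have "\<dots> = a * c - b\<^sup>2"
      using False by (simp add: field_simps power2_eq_square)
    finally show ?thesis by simp
  qed
  then have "\<bar>b\<bar> \<le> sqrt (a * c)"
    by (metis real_sqrt_abs real_sqrt_le_iff)
  also have "\<dots> = L2_norm f * L2_norm g"
    by (simp add: a_def c_def real_sqrt_mult flip: L2_norm_square)
  finally show ?thesis by (simp add: b_def)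
qed

lemma L2_norm_add_square:
  assumes "f \<in> L2" "g \<in> L2"
  shows "(L2_norm (\<lambda>x. f x + g x))\<^sup>2 = (L2_norm f)\<^sup>2 + 2 * L2_inner f g + (L2_norm g)\<^sup>2"
proof -
  let ?h = "\<lambda>x. f x + g x"
  have "?h \<in> L2" using assms by (rule L2_add)
  then have "L2_inner ?h ?h = L2_inner ?h f + L2_inner ?h g"
    using assms by (simp add: L2_inner_add_right)
  also have "\<dots> = L2_inner f ?h + L2_inner g ?h"
    by (simp only: L2_inner_commute)
  also have "\<dots> = L2_inner f f + 2 * L2_inner f g + L2_inner g g"
    using assms by (simp add: L2_inner_add_right L2_inner_commute[of g f])
  finally show ?thesis by (simp add: L2_norm_square)
qed

lemma L2_norm_triangle:
  assumes "f \<in> L2" "g \<in> L2"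
  shows "L2_norm (\<lambda>x. f x + g x) \<le> L2_norm f + L2_norm g"
proof (rule power2_le_imp_le)
  show "(L2_norm (\<lambda>x. f x + g x))\<^sup>2 \<le> (L2_norm f + L2_norm g)\<^sup>2"
    using L2_inner_bound[OF assms] by (simp add: L2_norm_add_square[OF assms] power2_sum)
qed simp

section \<open>Invariance under changes on null sets, bounded multipliers, Borel
  representatives\<close>

lemma L2_norm_cong_AE:
  assumes "AE x in lebesgue. f x = g x"
    "f \<in> borel_measurable lebesgue" "g \<in> borel_measurable lebesgue"
  shows "L2_norm f = L2_norm g"
proof -
  have [measurable]: "f \<in> borel_measurable lebesgue" "g \<in> borel_measurable lebesgue"
    using assms by auto
  have "(LINT x|lebesgue. (norm (f x))\<^sup>2) = (LINT x|lebesgue. (norm (g x))\<^sup>2)"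
    by (rule integral_cong_AE) (use assms(1) in \<open>auto elim: eventually_mono\<close>)
  then show ?thesis by (simp add: L2_norm_def)
qed

lemma L2_cong_AE:
  assumes "AE x in lebesgue. f x = g x" "f \<in> L2" "g \<in> borel_measurable lebesgue"
  shows "g \<in> L2"
proof -
  have [measurable]: "f \<in> borel_measurable lebesgue" "g \<in> borel_measurable lebesgue"
    using assms by (auto simp: L2_def)
  have "integrable lebesgue (\<lambda>x. (norm (g x))\<^sup>2) = integrable lebesgue (\<lambda>x. (norm (f x))\<^sup>2)"
    by (rule integrable_cong_AE) (use assms(1) in \<open>auto elim: eventually_mono\<close>)
  then show ?thesis using assms by (simp add: L2_def)
qed

lemma L2_inner_cong_AE:
  assumes "AE x in lebesgue. f x = f' x" "AE x in lebesgue. g x = g' x"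
    "f \<in> borel_measurable lebesgue" "f' \<in> borel_measurable lebesgue"
    "g \<in> borel_measurable lebesgue" "g' \<in> borel_measurable lebesgue"
  shows "L2_inner f g = L2_inner f' g'"
proof -
  have [measurable]: "f \<in> borel_measurable lebesgue" "g \<in> borel_measurable lebesgue"
    "f' \<in> borel_measurable lebesgue" "g' \<in> borel_measurable lebesgue"
    using assms by auto
  have "AE x in lebesgue. f x \<bullet> g x = f' x \<bullet> g' x" using assms(1,2) by eventually_elim simp
  then show ?thesis unfolding L2_inner_def by (intro integral_cong_AE) auto
qed

lemma L2_norm_bounded_mult_le:
  fixes q :: "'a::euclidean_space \<Rightarrow> real"
  assumes "f \<in> L2" "q \<in> borel_measurable lebesgue" "AE x in lebesgue. \<bar>q x\<bar> \<le> C" "C \<ge> 0"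
  shows "L2_norm (\<lambda>x. q x *\<^sub>R f x) \<le> C * L2_norm f"
proof -
  have "(LINT x|lebesgue. (norm (q x *\<^sub>R f x))\<^sup>2) \<le> (LINT x|lebesgue. C\<^sup>2 * (norm (f x))\<^sup>2)"
  proof (rule integral_mono_AE)
    show "integrable lebesgue (\<lambda>x. (norm (q x *\<^sub>R f x))\<^sup>2)"
      using L2_bounded_mult[OF assms(1-3)] by (auto simp: L2_def)
    show "integrable lebesgue (\<lambda>x. C\<^sup>2 * (norm (f x))\<^sup>2)"
      using assms by (auto simp: L2_def)
    show "AE x in lebesgue. (norm (q x *\<^sub>R f x))\<^sup>2 \<le> C\<^sup>2 * (norm (f x))\<^sup>2"
      using assms(3)
    proof eventually_elim
      case (elim x)
      then have "\<bar>q x\<bar>\<^sup>2 \<le> C\<^sup>2" by (intro power_mono) auto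
      then show ?case by (simp add: power_mult_distrib mult_right_mono)
    qed
  qed
  from real_sqrt_le_mono[OF this] show ?thesis
    using assms(4) by (simp add: L2_norm_def real_sqrt_mult)
qed

lemma L2_nn_integral:
  assumes "f \<in> L2"
  shows "(\<integral>\<^sup>+x. ennreal ((norm (f x))\<^sup>2) \<partial>lebesgue) = ennreal ((L2_norm f)\<^sup>2)"
  using assms by (subst nn_integral_eq_integral) (auto simp: L2_def L2_norm_def)

text \<open>A nonnegative integral exists without prior integrability, so one bound on it yields
  both membership and the norm estimate.\<close>

lemma L2_I_nn_integral:
  assumes "f \<in> borel_measurable lebesgue" "0 \<le> e"
    and le: "(\<integral>\<^sup>+x. ennreal ((norm (f x))\<^sup>2) \<partial>lebesgue) \<le> ennreal (e\<^sup>2)"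
  shows "f \<in> L2" "L2_norm f \<le> e"
proof -
  have [measurable]: "f \<in> borel_measurable lebesgue" by fact
  show "f \<in> L2"
    unfolding L2_def mem_Collect_eq using le
    by (auto simp: integrable_iff_bounded intro: le_less_trans)
  then have "ennreal ((L2_norm f)\<^sup>2) \<le> ennreal (e\<^sup>2)" using le by (simp add: L2_nn_integral)
  then have "(L2_norm f)\<^sup>2 \<le> e\<^sup>2" by (simp add: ennreal_le_iff)
  then show "L2_norm f \<le> e" using assms(2) by (rule power2_le_imp_le)
qed

text \<open>For a merely Lebesgue measurable f, the map (x, y) to f (x - y) need not be measurable
  on the product of the Borel spaces, where Tonelli and Fubini are applied below. Convolution
  arguments are therefore run on a Borel version and transferred back.\<close>

lemma L2_borel_version:
  assumes "f \<in> borel_measurable lebesgue"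
  obtains f' :: "'a::euclidean_space \<Rightarrow> complex"
  where "f' \<in> borel_measurable borel" "AE x in lebesgue. f x = f' x"
proof -
  have [measurable]: "f \<in> borel_measurable lebesgue" by fact
  have "(\<lambda>x. Re (f x)) \<in> borel_measurable lebesgue" by measurable
  from completion_ex_borel_measurable_real[OF this] obtain a
    where a: "a \<in> borel_measurable lborel" "AE x in lborel. Re (f x) = a x" by auto
  have "(\<lambda>x. Im (f x)) \<in> borel_measurable lebesgue" by measurable
  from completion_ex_borel_measurable_real[OF this] obtain b
    where b: "b \<in> borel_measurable lborel" "AE x in lborel. Im (f x) = b x" by auto
  have [measurable]: "a \<in> borel_measurable borel" "b \<in> borel_measurable borel"
    using a b by auto
  show thesis
  proof
    show "(\<lambda>x. Complex (a x) (b x)) \<in> borel_measurable borel"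
      unfolding Complex_eq by measurable
    show "AE x in lebesgue. f x = Complex (a x) (b x)"
      using AE_completion[OF a(2)] AE_completion[OF b(2)]
      by eventually_elim (simp add: complex_eq_iff)
  qed
qed

section \<open>Test functions\<close>

text \<open>One affine family serves all kernels that occur: the rescaled mollifier, the kernel y to
  k (x - y) at fixed x, the reflection k (- y) and the negative of k.\<close>

lemma partial_affine:
  assumes "f differentiable (at (a + s *\<^sub>R y))"
  shows "((\<lambda>y. c * f (a + s *\<^sub>R y)) has_derivative
      (\<lambda>h. c * frechet_derivative f (at (a + s *\<^sub>R y)) (s *\<^sub>R h))) (at y)" (is ?D)
    and "partial b (\<lambda>y. c * f (a + s *\<^sub>R y)) y = (c * s) * partial b f (a + s *\<^sub>R y)"
proof -
  have f: "(f has_derivative frechet_derivative f (at (a + s *\<^sub>R y))) (at (a + s *\<^sub>R y))"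
    using assms by (simp add: frechet_derivative_works)
  have "((\<lambda>y. a + s *\<^sub>R y) has_derivative (\<lambda>h. s *\<^sub>R h)) (at y)"
    by (auto intro!: derivative_eq_intros)
  from has_derivative_mult_right[OF has_derivative_compose[OF this f]]
  show D: ?D .
  have lin: "linear (frechet_derivative f (at (a + s *\<^sub>R y)))"
    using assms by (rule linear_frechet_derivative)
  show "partial b (\<lambda>y. c * f (a + s *\<^sub>R y)) y = (c * s) * partial b f (a + s *\<^sub>R y)"
    unfolding partial_def frechet_derivative_at[OF D, symmetric]
    using linear_scale[OF lin, of s b] by simp
qed

lemma smooth_differentiable: "smooth f \<Longrightarrow> f differentiable (at x)"
  using smooth_def[of f] by (metis empty_set empty_subsetI foldr_Nil id_apply)

lemma iterated_partial_affine:
  assumes "smooth f" "set bs \<subseteq> Basis"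
  shows "foldr partial bs (\<lambda>y. c * f (a + s *\<^sub>R y)) =
    (\<lambda>y. (c * s ^ length bs) * foldr partial bs f (a + s *\<^sub>R y))"
  using assms(2)
proof (induction bs)
  case (Cons b bs)
  have "foldr partial bs f differentiable (at x)" for x
    using assms(1) Cons.prems by (auto simp: smooth_def)
  from partial_affine(2)[OF this] have
    "partial b (\<lambda>y. (c * s ^ length bs) * foldr partial bs f (a + s *\<^sub>R y)) =
      (\<lambda>y. (c * s ^ length bs * s) * partial b (foldr partial bs f) (a + s *\<^sub>R y))"
    by (intro ext)
  moreover have "foldr partial bs (\<lambda>y. c * f (a + s *\<^sub>R y)) =
      (\<lambda>y. (c * s ^ length bs) * foldr partial bs f (a + s *\<^sub>R y))"
    using Cons by simp
  ultimately show ?case by (simp add: mult.assoc mult.commute[of s])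
qed simp

lemma smooth_affine:
  assumes "smooth f"
  shows "smooth (\<lambda>y. c * f (a + s *\<^sub>R y))"
  unfolding smooth_def
proof (intro allI impI)
  fix bs :: "'a list" and x :: 'a
  assume bs: "set bs \<subseteq> Basis"
  have "foldr partial bs f differentiable (at (a + s *\<^sub>R x))"
    using assms bs by (auto simp: smooth_def)
  from partial_affine(1)[OF this]
  show "foldr partial bs (\<lambda>y. c * f (a + s *\<^sub>R y)) differentiable (at x)"
    unfolding iterated_partial_affine[OF assms bs] by (rule differentiableI)
qed

lemma smooth_partial:
  assumes "smooth f" "b \<in> Basis"
  shows "smooth (partial b f)"
  unfolding smooth_def
proof (intro allI impI)
  fix bs :: "'a list" and x :: 'a
  assume "set bs \<subseteq> Basis"
  \<comment> \<open>\<open>foldr\<close> applies the last entry first, so appending b to the list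
    amounts to starting from \<open>partial b f\<close>.\<close>
  then have "foldr partial (bs @ [b]) f differentiable (at x)"
    using assms unfolding smooth_def by (metis insert_subset list.simps(15) set_append Un_subset_iff empty_set empty_subsetI)
  then show "foldr partial bs (partial b f) differentiable (at x)" by simp
qed

lemma test_function_affine:
  assumes "test_function f" "s \<noteq> 0"
  shows "test_function (\<lambda>y. c * f (a + s *\<^sub>R y))"
proof -
  have "bounded {x. f x \<noteq> 0}"
    using assms(1) by (simp add: test_function_def compact_closure)
  then have "bounded ((\<lambda>z. (1 / s) *\<^sub>R (z - a)) ` {x. f x \<noteq> 0})"
    by (intro bounded_scaling[of "(\<lambda>z. z - a) ` _", unfolded image_image] bounded_translation_minus)
  moreover have "{y. c * f (a + s *\<^sub>R y) \<noteq> 0} \<subseteq> (\<lambda>z. (1 / s) *\<^sub>R (z - a)) ` {x. f x \<noteq> 0}"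
  proof
    fix y assume "y \<in> {y. c * f (a + s *\<^sub>R y) \<noteq> 0}"
    then have "a + s *\<^sub>R y \<in> {x. f x \<noteq> 0}" by auto
    moreover have "y = (1 / s) *\<^sub>R ((a + s *\<^sub>R y) - a)" using assms(2) by simp
    ultimately show "y \<in> (\<lambda>z. (1 / s) *\<^sub>R (z - a)) ` {x. f x \<noteq> 0}" by blast
  qed
  ultimately have "bounded {y. c * f (a + s *\<^sub>R y) \<noteq> 0}" by (rule bounded_subset)
  then show ?thesis
    using assms(1) smooth_affine by (auto simp: test_function_def compact_closure)
qed

text \<open>Differentiation does not enlarge the support: off the closure of the nonzero set, f
  vanishes on a neighbourhood, and so does its derivative.\<close>

lemma test_function_partial:
  assumes "test_function f" "b \<in> Basis"
  shows "test_function (partial b f)"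
proof -
  let ?S = "closure {x. f x \<noteq> 0}"
  have "{x. partial b f x \<noteq> 0} \<subseteq> ?S"
  proof
    fix x assume "x \<in> {x. partial b f x \<noteq> 0}"
    then have nz: "frechet_derivative f (at x) b \<noteq> 0" by (simp add: partial_def)
    show "x \<in> ?S"
    proof (rule ccontr)
      assume "x \<notin> ?S"
      then have "((\<lambda>x. 0) has_derivative (\<lambda>h. 0)) (at x)" "open (- ?S)" "x \<in> - ?S" by auto
      then have "(f has_derivative (\<lambda>h. 0)) (at x)"
      proof (rule has_derivative_transform_within_open)
        show "0 = f z" if "z \<in> - ?S" for z
          using that closure_subset[of "{x. f x \<noteq> 0}"] by auto
      qed
      then have "frechet_derivative f (at x) = (\<lambda>h. 0)" by (metis frechet_derivative_at)
      with nz show False by simp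
    qed
  qed
  then have "compact (closure {x. partial b f x \<noteq> 0})"
    using assms(1) unfolding test_function_def compact_closure
    by (meson bounded_closure bounded_subset)
  with assms smooth_partial show ?thesis by (auto simp: test_function_def)
qed

lemma test_function_continuous: "test_function f \<Longrightarrow> continuous_on UNIV f"
  by (meson continuous_at_imp_continuous_on differentiable_imp_continuous_within
      smooth_differentiable test_function_def)

lemma test_function_borel: "test_function f \<Longrightarrow> f \<in> borel_measurable borel"
  by (intro borel_measurable_continuous_onI test_function_continuous)

lemma test_function_measurable: "test_function f \<Longrightarrow> f \<in> borel_measurable lebesgue"
  using test_function_borel by (intro measurable_completion) auto

lemma compact_support_integrable:
  fixes f :: "'a::euclidean_space \<Rightarrow> real"
  assumes "continuous_on UNIV f" "compact S" "\<And>x. x \<notin> S \<Longrightarrow> f x = 0"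
  shows "integrable lborel f"
proof -
  have "integrable lborel (\<lambda>x. indicator S x *\<^sub>R f x)"
    using assms by (intro borel_integrable_compact) (auto intro: continuous_on_subset)
  moreover have "(\<lambda>x. indicator S x *\<^sub>R f x) = f"
    using assms(3) by (auto simp: fun_eq_iff indicator_def)
  ultimately show ?thesis by simp
qed

lemma test_function_integrable:
  assumes "test_function f"
  shows "integrable lborel f" "integrable lborel (\<lambda>x. (f x)\<^sup>2)" "integrable lborel (\<lambda>x. \<bar>f x\<bar>)"
proof -
  define S where "S = closure {x. f x \<noteq> 0}"
  have S: "compact S" "\<And>x. x \<notin> S \<Longrightarrow> f x = 0"
    using assms closure_subset[of "{x. f x \<noteq> 0}"] by (auto simp: test_function_def S_def)
  note c = test_function_continuous[OF assms]
  show "integrable lborel f"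
    by (rule compact_support_integrable[OF c S])
  show "integrable lborel (\<lambda>x. (f x)\<^sup>2)"
    by (rule compact_support_integrable[OF continuous_on_power[OF c] S(1)]) (simp add: S(2))
  show "integrable lborel (\<lambda>x. \<bar>f x\<bar>)"
    by (rule compact_support_integrable[OF continuous_on_rabs[OF c] S(1)]) (simp add: S(2))
qed

lemma test_function_mult_L2_integrable:
  assumes "test_function \<phi>" "f \<in> L2"
  shows "integrable lebesgue (\<lambda>x. \<phi> x *\<^sub>R f x)"
proof -
  have [measurable]: "\<phi> \<in> borel_measurable lebesgue" "f \<in> borel_measurable lebesgue"
    using assms by (auto simp: test_function_measurable L2_measurable)
  have "integrable lebesgue (\<lambda>x. (\<phi> x)\<^sup>2)"
    using test_function_integrable(2)[OF assms(1)] test_function_borel[OF assms(1)]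
    by (subst integrable_completion) auto
  then have "integrable lebesgue (\<lambda>x. (\<phi> x)\<^sup>2 + (norm (f x))\<^sup>2)"
    using assms(2) by (auto simp: L2_def)
  then show ?thesis
  proof (rule Bochner_Integration.integrable_bound)
    show "AE x in lebesgue. norm (\<phi> x *\<^sub>R f x) \<le> norm ((\<phi> x)\<^sup>2 + (norm (f x))\<^sup>2)"
    proof (rule AE_I2)
      fix x
      have "\<bar>\<phi> x\<bar> * norm (f x) \<le> (\<phi> x)\<^sup>2 + (norm (f x))\<^sup>2"
        using sum_squares_bound[of "\<bar>\<phi> x\<bar>" "norm (f x)"]
          mult_nonneg_nonneg[OF abs_ge_zero norm_ge_zero, of "\<phi> x" "f x"]
        unfolding power2_abs by linarith
      then show "norm (\<phi> x *\<^sub>R f x) \<le> norm ((\<phi> x)\<^sup>2 + (norm (f x))\<^sup>2)" by simp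
    qed
  qed measurable
qed

section \<open>Affine substitutions and translations\<close>

text \<open>Used with c = 1 for translations, c = -1 for reflections and c = 1 / r for the rescaled
  mollifier.\<close>

lemma lborel_integral_affine:
  fixes f :: "'a::euclidean_space \<Rightarrow> 'b::{banach, second_countable_topology}"
  assumes [measurable]: "f \<in> borel_measurable borel" and "c \<noteq> 0"
  shows "(LINT x|lborel. f x) = \<bar>c\<bar> ^ DIM('a) *\<^sub>R (LINT x|lborel. f (t + c *\<^sub>R x))"
  by (subst lborel_affine[OF \<open>c \<noteq> 0\<close>, of t])
    (simp add: integral_density integral_distr)

lemma lborel_integrable_affine:
  fixes f :: "'a::euclidean_space \<Rightarrow> 'b::{banach, second_countable_topology}"
  assumes [measurable]: "f \<in> borel_measurable borel" and "c \<noteq> 0" and "integrable lborel f"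
  shows "integrable lborel (\<lambda>x. f (t + c *\<^sub>R x))"
proof -
  have "integrable lborel (\<lambda>x. \<bar>c\<bar> ^ DIM('a) *\<^sub>R f (t + c *\<^sub>R x))"
    using assms(3)
    by (subst (asm) lborel_affine[OF \<open>c \<noteq> 0\<close>, of t])
      (simp add: integrable_density integrable_distr_eq)
  then have "integrable lborel (\<lambda>x. (1 / \<bar>c\<bar> ^ DIM('a)) *\<^sub>R \<bar>c\<bar> ^ DIM('a) *\<^sub>R f (t + c *\<^sub>R x))"
    by (rule integrable_scaleR_right)
  then show ?thesis using \<open>c \<noteq> 0\<close> by simp
qed

lemma lborel_integral_translate:
  fixes f :: "'a::euclidean_space \<Rightarrow> 'b::{banach, second_countable_topology}"
  assumes "f \<in> borel_measurable borel"
  shows "(LINT x|lborel. f (x - h)) = (LINT x|lborel. f x)"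
  using lborel_integral_affine[OF assms, of 1 "- h"] by simp

lemma lborel_integrable_translate:
  fixes f :: "'a::euclidean_space \<Rightarrow> 'b::{banach, second_countable_topology}"
  assumes "integrable lborel f"
  shows "integrable lborel (\<lambda>x. f (x - h))"
  using lborel_integrable_affine[of f 1 "- h"] assms by (auto dest: borel_measurable_integrable)

section \<open>Continuity of translations\<close>

text \<open>Continuity of translations is proved in L1 first, where induction over integrable
  functions applies directly; the L2 case is then reduced to it through squares.\<close>

definition L1_shift :: "('a::euclidean_space \<Rightarrow> real) \<Rightarrow> 'a \<Rightarrow> real" where
  "L1_shift f h = (LINT x|lborel. \<bar>f (x - h) - f x\<bar>)"

lemma L1_shift_integrable:
  fixes f :: "'a::euclidean_space \<Rightarrow> real"
  assumes "integrable lborel f"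
  shows "integrable lborel (\<lambda>x. \<bar>f (x - h) - f x\<bar>)"
  using assms lborel_integrable_translate[OF assms, of h] by auto

lemma L1_shift_nonneg [simp]: "0 \<le> L1_shift f h"
  by (simp add: L1_shift_def)

text \<open>A three-term estimate: by translation invariance the error between f and g after the
  shift equals the error before it, so a good approximant g controls f for all h at once.\<close>

lemma L1_shift_approx:
  assumes f: "integrable lborel f"
    and approx: "\<And>e. 0 < e \<Longrightarrow> \<exists>g. integrable lborel g \<and> (LINT x|lborel. \<bar>f x - g x\<bar>) < e \<and>
      (L1_shift g \<longlongrightarrow> 0) (at 0)"
  shows "(L1_shift f \<longlongrightarrow> 0) (at 0)"
proof (rule tendstoI)
  fix e :: real assume "0 < e"
  then obtain g where g: "integrable lborel g" "(LINT x|lborel. \<bar>f x - g x\<bar>) < e / 3"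
    "(L1_shift g \<longlongrightarrow> 0) (at 0)"
    using approx[of "e / 3"] by auto
  have fg: "integrable lborel (\<lambda>x. \<bar>f x - g x\<bar>)" using f g by auto
  have "\<forall>\<^sub>F h in at 0. L1_shift g h < e / 3"
    using order_tendstoD(2)[OF g(3), of "e / 3"] \<open>0 < e\<close> by simp
  then show "\<forall>\<^sub>F h in at 0. dist (L1_shift f h) 0 < e"
  proof eventually_elim
    case (elim h)
    have "L1_shift f h \<le> (LINT x|lborel. \<bar>f (x - h) - g (x - h)\<bar> + \<bar>g (x - h) - g x\<bar> + \<bar>f x - g x\<bar>)"
      unfolding L1_shift_def
      by (intro integral_mono L1_shift_integrable Bochner_Integration.integrable_add
          lborel_integrable_translate[OF fg] fg f g) auto
    also have "\<dots> = (LINT x|lborel. \<bar>f (x - h) - g (x - h)\<bar>) + L1_shift g h + (LINT x|lborel. \<bar>f x - g x\<bar>)"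
      unfolding L1_shift_def
      using lborel_integrable_translate[OF fg, of h] fg L1_shift_integrable[OF g(1), of h] by simp
    also have "(LINT x|lborel. \<bar>f (x - h) - g (x - h)\<bar>) = (LINT x|lborel. \<bar>f x - g x\<bar>)"
      using fg by (intro lborel_integral_translate[where f = "\<lambda>x. \<bar>f x - g x\<bar>"]) (auto dest: borel_measurable_integrable)
    finally show ?case using elim g(2) by simp
  qed
qed

text \<open>
  By openness the positive part of \<open>1\<^sub>T - 1\<^sub>T(\<cdot> - h)\<close> tends to \<open>0\<close> pointwise and is dominated by \<open>1\<^sub>T\<close>;
  the negative part has the same integral, because the difference has integral \<open>0\<close>.
\<close>

lemma L1_shift_open_indicator:
  fixes T :: "'a::euclidean_space set"
  assumes "open T" "emeasure lborel T < \<infinity>"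
  shows "(L1_shift (indicator T) \<longlongrightarrow> 0) (at 0)"
proof -
  let ?m = "\<lambda>h x. max 0 (indicator T x - indicator T (x - h) :: real)"
  have [measurable]: "T \<in> sets borel" using assms(1) by auto
  have int: "integrable lborel (indicator T :: 'a \<Rightarrow> real)"
    using assms by (auto simp: integrable_indicator_iff)
  have sh: "integrable lborel (\<lambda>x. indicator T (x - h) :: real)" for h
    by (rule lborel_integrable_translate[OF int])
  have mint: "integrable lborel (?m h)" for h
    using int sh[of h] by (intro integrable_max) auto
  have eq: "L1_shift (indicator T) h = 2 * (LINT x|lborel. ?m h x)" for h
  proof -
    have "L1_shift (indicator T) h = (LINT x|lborel. 2 * ?m h x - (indicator T x - indicator T (x - h)))"
      unfolding L1_shift_def by (intro Bochner_Integration.integral_cong) (auto simp: max_def)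
    also have "\<dots> = 2 * (LINT x|lborel. ?m h x) -
        ((LINT x|lborel. indicator T x) - (LINT x|lborel. indicator T (x - h)))"
      using mint[of h] int sh[of h] by simp
    also have "(LINT x|lborel. indicator T (x - h)) = (LINT x|lborel. indicator T x :: real)"
      by (rule lborel_integral_translate) measurable
    finally show ?thesis by simp
  qed
  \<comment> \<open>Dominated convergence is applied along an arbitrary sequence of shifts, which
    determines the limit at 0.\<close>
  have "((\<lambda>h. LINT x|lborel. ?m h x) \<longlongrightarrow> 0) (at 0)"
    unfolding tendsto_at_iff_sequentially
  proof (intro allI impI)
    fix X :: "nat \<Rightarrow> 'a" assume X: "X \<longlonglongrightarrow> 0"
    have "(\<lambda>i. LINT x|lborel. ?m (X i) x) \<longlonglongrightarrow> integral\<^sup>L lborel (\<lambda>x::'a. 0 :: real)"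
    proof (rule integral_dominated_convergence)
      show "integrable lborel (indicator T :: 'a \<Rightarrow> real)" by (rule int)
      show "AE x in lborel. (\<lambda>i. ?m (X i) x) \<longlonglongrightarrow> 0"
      proof (rule AE_I2)
        fix x
        show "(\<lambda>i. ?m (X i) x) \<longlonglongrightarrow> 0"
        proof (cases "x \<in> T")
          case True
          have "(\<lambda>i. x - X i) \<longlonglongrightarrow> x - 0" by (intro tendsto_intros X)
          then have "\<forall>\<^sub>F i in sequentially. x - X i \<in> T"
            using assms(1) True by (auto intro: topological_tendstoD)
          then have "\<forall>\<^sub>F i in sequentially. ?m (X i) x = 0"
            by eventually_elim (use True in simp)
          then show ?thesis by (rule tendsto_eventually)
        next
          case False
          \<comment> \<open>Outside T the difference is never positive, whatever the shift; openness
            matters only at points of T.\<close>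
          then have "?m (X i) x = 0" for i by (simp add: indicator_def)
          then show ?thesis by simp
        qed
      qed
      show "AE x in lborel. norm (?m (X i) x) \<le> indicator T x" for i
        by (rule AE_I2) (auto simp: indicator_def)
    qed measurable
    then show "((\<lambda>h. LINT x|lborel. ?m h x) \<circ> X) \<longlonglongrightarrow> 0" by (simp add: comp_def)
  qed
  then have "((\<lambda>h. 2 * (LINT x|lborel. ?m h x)) \<longlongrightarrow> 2 * 0) (at 0)"
    by (rule tendsto_mult_left)
  then show ?thesis by (simp add: eq[abs_def])
qed

text \<open>Outer regularity of Lebesgue measure gives an open superset of A with excess less than
  e, and the open case applies to it because its measure is still finite.\<close>

lemma L1_shift_indicator:
  fixes A :: "'a::euclidean_space set"
  assumes A: "A \<in> sets borel" "emeasure lborel A < \<infinity>"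
  shows "(L1_shift (indicator A) \<longlongrightarrow> 0) (at 0)"
proof (rule L1_shift_approx)
  have [measurable]: "A \<in> sets borel" by fact
  show "integrable lborel (indicator A :: 'a \<Rightarrow> real)"
    using A by (auto simp: integrable_indicator_iff)
  fix e :: real assume "0 < e"
  obtain T where T: "open T" "A \<subseteq> T" "emeasure lebesgue (T - A) < ennreal e"
    using sets_lebesgue_outer_open[of A e] A \<open>0 < e\<close> by auto
  have [measurable]: "T \<in> sets borel" using T(1) by auto
  have TA: "emeasure lborel (T - A) < ennreal e" using T(3) by simp
  have "emeasure lborel T = emeasure lborel (A \<union> (T - A))" using T(2) by (simp add: Un_absorb1)
  also have "\<dots> \<le> emeasure lborel A + emeasure lborel (T - A)" by (rule emeasure_subadditive) auto
  also have "\<dots> < \<infinity>" using A(2) less_trans[OF TA ennreal_less_top] by (simp add: less_top)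
  finally have fin: "emeasure lborel T < \<infinity>" .
  have "(LINT x|lborel. \<bar>indicator A x - indicator T x :: real\<bar>) = (LINT x|lborel. indicator (T - A) x)"
    using T(2) by (intro Bochner_Integration.integral_cong) (auto simp: indicator_def)
  also have "\<dots> = measure lborel (T - A)" by simp
  also have "\<dots> < e"
  proof -
    have "emeasure lborel (T - A) \<noteq> top" using TA by (metis ennreal_less_top less_trans less_irrefl)
    then have "ennreal (measure lborel (T - A)) < ennreal e" using TA emeasure_eq_ennreal_measure by metis
    then show ?thesis by (simp add: ennreal_less_iff)
  qed
  finally show "\<exists>g. integrable lborel g \<and> (LINT x|lborel. \<bar>indicator A x - g x\<bar>) < e \<and>
      (L1_shift g \<longlongrightarrow> 0) (at 0)"
    using fin L1_shift_open_indicator[OF T(1) fin]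
    by (intro exI[of _ "indicator T"]) (auto simp: integrable_indicator_iff)
qed

lemma L1_shift_tendsto:
  fixes f :: "'a::euclidean_space \<Rightarrow> real"
  assumes "integrable lborel f"
  shows "(L1_shift f \<longlongrightarrow> 0) (at 0)"
  using assms
proof (induction rule: integrable_induct)
  case (base A c)
  have "L1_shift (\<lambda>x. indicator A x *\<^sub>R c) = (\<lambda>h. \<bar>c\<bar> * L1_shift (indicator A) h)"
  proof
    fix h
    have "\<bar>indicator A (x - h) *\<^sub>R c - indicator A x *\<^sub>R c\<bar> =
        \<bar>c\<bar> * \<bar>indicator A (x - h) - indicator A x\<bar>" for x
      unfolding real_scaleR_def left_diff_distrib[symmetric] by (simp add: abs_mult)
    then show "L1_shift (\<lambda>x. indicator A x *\<^sub>R c) h = \<bar>c\<bar> * L1_shift (indicator A) h"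
      by (simp add: L1_shift_def)
  qed
  moreover have "((\<lambda>h. \<bar>c\<bar> * L1_shift (indicator A) h) \<longlongrightarrow> \<bar>c\<bar> * 0) (at 0)"
    using base by (intro tendsto_mult_left L1_shift_indicator) auto
  ultimately show ?case by simp
next
  case (add f g)
  have "((\<lambda>h. L1_shift f h + L1_shift g h) \<longlongrightarrow> 0 + 0) (at 0)"
    using add by (intro tendsto_add) auto
  then show ?case
  proof (rule Lim_null_comparison[rotated, OF tendsto_eq_rhs])
    show "\<forall>\<^sub>F h in at 0. norm (L1_shift (\<lambda>x. f x + g x) h) \<le> L1_shift f h + L1_shift g h"
    proof (rule always_eventually, rule allI)
      fix h
      have "L1_shift (\<lambda>x. f x + g x) h \<le> (LINT x|lborel. \<bar>f (x - h) - f x\<bar> + \<bar>g (x - h) - g x\<bar>)"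
        unfolding L1_shift_def using add
        by (intro integral_mono L1_shift_integrable[of "\<lambda>x. f x + g x"] Bochner_Integration.integrable_add
            L1_shift_integrable) auto
      also have "\<dots> = L1_shift f h + L1_shift g h"
        unfolding L1_shift_def using add L1_shift_integrable by (intro Bochner_Integration.integral_add) auto
      finally show "norm (L1_shift (\<lambda>x. f x + g x) h) \<le> L1_shift f h + L1_shift g h" by simp
    qed
  qed simp
next
  case (lim f s)
  note [measurable] = borel_measurable_integrable[OF lim.hyps(1)] borel_measurable_integrable[OF lim.hyps(4)]
  have "(\<lambda>i. LINT x|lborel. \<bar>f x - s i x\<bar>) \<longlonglongrightarrow> integral\<^sup>L lborel (\<lambda>x::'a. 0 :: real)"
  proof (rule integral_dominated_convergence)
    \<comment> \<open>The induction rule supplies approximants with |s i x| \<le> 2 |f x|; adding |f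
      x| gives the factor 3.\<close>
    show "integrable lborel (\<lambda>x. 3 * \<bar>f x\<bar>)" using lim.hyps(4) by auto
    show "AE x in lborel. (\<lambda>i. \<bar>f x - s i x\<bar>) \<longlonglongrightarrow> 0"
    proof (rule AE_I2)
      fix x
      have "(\<lambda>i. \<bar>f x - s i x\<bar>) \<longlonglongrightarrow> \<bar>f x - f x\<bar>"
        using lim.hyps(2)[of x] by (intro tendsto_intros) auto
      then show "(\<lambda>i. \<bar>f x - s i x\<bar>) \<longlonglongrightarrow> 0" by simp
    qed
    show "AE x in lborel. norm \<bar>f x - s i x\<bar> \<le> 3 * \<bar>f x\<bar>" for i
    proof (rule AE_I2)
      fix x
      show "norm \<bar>f x - s i x\<bar> \<le> 3 * \<bar>f x\<bar>" using lim.hyps(3)[of x i] by simp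
    qed
  qed measurable
  then have conv: "(\<lambda>i. LINT x|lborel. \<bar>f x - s i x\<bar>) \<longlonglongrightarrow> 0" by simp
  show ?case
  proof (rule L1_shift_approx[OF lim.hyps(4)])
    fix e :: real assume "0 < e"
    from order_tendstoD(2)[OF conv this] obtain i where "(LINT x|lborel. \<bar>f x - s i x\<bar>) < e"
      by (auto simp: eventually_sequentially)
    then show "\<exists>g. integrable lborel g \<and> (LINT x|lborel. \<bar>f x - g x\<bar>) < e \<and> (L1_shift g \<longlongrightarrow> 0) (at 0)"
      using lim.hyps(1) lim.IH by blast
  qed
qed

text \<open>For nonnegative numbers |a - b| \<le> a + b. This is the bridge from L2 to L1: it bounds
  the squared increment of a function by the increment of its square.\<close>

lemma square_diff_le_abs_diff_squares:
  fixes a b :: real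
  assumes "0 \<le> a" "0 \<le> b"
  shows "(a - b)\<^sup>2 \<le> \<bar>a\<^sup>2 - b\<^sup>2\<bar>"
proof -
  have "\<bar>a - b\<bar> * \<bar>a - b\<bar> \<le> \<bar>a - b\<bar> * (a + b)"
    using assms by (intro mult_left_mono) auto
  also have "\<dots> = \<bar>(a - b) * (a + b)\<bar>" using assms by (simp add: abs_mult)
  finally show ?thesis by (simp add: power2_eq_square algebra_simps)
qed

text \<open>The preceding inequality fails for mixed signs, as a = 1, b = -1 shows, so it is applied
  to positive and negative parts separately. The factor 2 comes from (x + y)^2 \<le> 2 (x^2 +
  y^2).\<close>

lemma square_diff_le_parts:
  fixes a b :: real
  shows "(a - b)\<^sup>2 \<le> 2 * (\<bar>(max 0 a)\<^sup>2 - (max 0 b)\<^sup>2\<bar> + \<bar>(max 0 (- a))\<^sup>2 - (max 0 (- b))\<^sup>2\<bar>)"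
proof -
  have "(a - b)\<^sup>2 = ((max 0 a - max 0 b) + - (max 0 (- a) - max 0 (- b)))\<^sup>2"
    by (simp add: max_def)
  also have "\<dots> \<le> 2 * ((max 0 a - max 0 b)\<^sup>2 + (max 0 (- a) - max 0 (- b))\<^sup>2)"
    using sum_squares_bound[of "max 0 a - max 0 b" "- (max 0 (- a) - max 0 (- b))"]
    by (simp only: power2_sum power2_minus) simp
  also have "\<dots> \<le> 2 * (\<bar>(max 0 a)\<^sup>2 - (max 0 b)\<^sup>2\<bar> + \<bar>(max 0 (- a))\<^sup>2 - (max 0 (- b))\<^sup>2\<bar>)"
    by (intro mult_left_mono add_mono square_diff_le_abs_diff_squares) auto
  finally show ?thesis .
qed

lemma borel_L2_iff:
  assumes "f \<in> borel_measurable borel"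
  shows "f \<in> L2 \<longleftrightarrow> integrable lborel (\<lambda>x. (norm (f x))\<^sup>2)"
proof -
  have [measurable]: "f \<in> borel_measurable borel" by fact
  have "f \<in> borel_measurable lebesgue" by (intro measurable_completion) simp
  then show ?thesis unfolding L2_def mem_Collect_eq by (subst integrable_completion) auto
qed

lemma L2_norm_lborel:
  assumes [measurable]: "f \<in> borel_measurable borel"
  shows "L2_norm f = sqrt (LINT x|lborel. (norm (f x))\<^sup>2)"
  unfolding L2_norm_def by (subst integral_completion) auto

lemma L2_translate:
  assumes "f \<in> borel_measurable borel" "f \<in> L2"
  shows "(\<lambda>x. f (x - h)) \<in> L2"
proof -
  have [measurable]: "f \<in> borel_measurable borel" by fact
  show ?thesis
    using lborel_integrable_translate[of "\<lambda>x. (norm (f x))\<^sup>2" h] assms by (simp add: borel_L2_iff)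
qed

lemma L2_shift_tendsto:
  assumes "f \<in> borel_measurable borel" "f \<in> L2"
  shows "((\<lambda>h. L2_norm (\<lambda>x. f (x - h) - f x)) \<longlongrightarrow> 0) (at 0)"
proof -
  have [measurable]: "f \<in> borel_measurable borel" by fact
  have f: "integrable lborel (\<lambda>x. (norm (f x))\<^sup>2)" using assms by (simp add: borel_L2_iff)
  \<comment> \<open>The squares of the four nonnegative parts of f. Each is integrable, being at
    most |f|^2, so the L1 result applies to each.\<close>
  define G :: "nat \<Rightarrow> 'a \<Rightarrow> real" where "G i x =
    (if i = 0 then (max 0 (Re (f x)))\<^sup>2 else if i = 1 then (max 0 (- Re (f x)))\<^sup>2
     else if i = 2 then (max 0 (Im (f x)))\<^sup>2 else (max 0 (- Im (f x)))\<^sup>2)" for i x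
  have G: "integrable lborel (G i)" for i
  proof (rule Bochner_Integration.integrable_bound[OF f])
    show "G i \<in> borel_measurable lborel" unfolding G_def[abs_def] by measurable
    show "AE x in lborel. norm (G i x) \<le> norm ((norm (f x))\<^sup>2)"
    proof (rule AE_I2)
      fix x
      have "(max 0 (Re (f x)))\<^sup>2 \<le> (Re (f x))\<^sup>2" "(max 0 (- Re (f x)))\<^sup>2 \<le> (Re (f x))\<^sup>2"
        "(max 0 (Im (f x)))\<^sup>2 \<le> (Im (f x))\<^sup>2" "(max 0 (- Im (f x)))\<^sup>2 \<le> (Im (f x))\<^sup>2"
        by (auto simp: max_def)
      then have "G i x \<le> (Re (f x))\<^sup>2 + (Im (f x))\<^sup>2"
        unfolding G_def by (auto intro: add_increasing add_increasing2)
      moreover have "0 \<le> G i x" by (simp add: G_def)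
      ultimately show "norm (G i x) \<le> norm ((norm (f x))\<^sup>2)" by (simp add: cmod_power2)
    qed
  qed
  let ?B = "\<lambda>h. 2 * (L1_shift (G 0) h + L1_shift (G 1) h + L1_shift (G 2) h + L1_shift (G 3) h)"
  have le: "L2_norm (\<lambda>x. f (x - h) - f x) \<le> sqrt (?B h)" for h
  proof -
    let ?g = "\<lambda>i x. \<bar>G i (x - h) - G i x\<bar>"
    have gi: "integrable lborel (?g i)" for i by (rule L1_shift_integrable[OF G])
    have "(LINT x|lborel. (norm (f (x - h) - f x))\<^sup>2) \<le>
        (LINT x|lborel. 2 * (?g 0 x + ?g 1 x + ?g 2 x + ?g 3 x))"
    proof (rule integral_mono)
      have "(\<lambda>x. f (x - h) - f x) \<in> L2" using L2_translate[OF assms] assms(2) by (rule L2_diff)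
      then show "integrable lborel (\<lambda>x. (norm (f (x - h) - f x))\<^sup>2)" by (subst (asm) borel_L2_iff) auto
      show "integrable lborel (\<lambda>x. 2 * (?g 0 x + ?g 1 x + ?g 2 x + ?g 3 x))"
        using gi by (intro integrable_mult_right Bochner_Integration.integrable_add)
      show "(norm (f (x - h) - f x))\<^sup>2 \<le> 2 * (?g 0 x + ?g 1 x + ?g 2 x + ?g 3 x)" for x
        using square_diff_le_parts[of "Re (f (x - h))" "Re (f x)"]
          square_diff_le_parts[of "Im (f (x - h))" "Im (f x)"]
        by (simp add: cmod_power2 G_def)
    qed
    also have "\<dots> = ?B h" unfolding L1_shift_def using gi by simp
    finally show ?thesis by (simp add: L2_norm_lborel)
  qed
  have "((\<lambda>h. sqrt (?B h)) \<longlongrightarrow> sqrt (2 * (0 + 0 + 0 + 0))) (at 0)"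
    by (intro tendsto_intros L1_shift_tendsto G)
  then have "((\<lambda>h. sqrt (?B h)) \<longlongrightarrow> 0) (at 0)" by simp
  then show ?thesis
    by (rule Lim_null_comparison[rotated])
      (rule always_eventually, simp only: real_norm_def abs_of_nonneg[OF L2_norm_nonneg] le, simp)
qed

section \<open>Mollification\<close>

text \<open>If f is not integrable, its Bochner integral is 0 by convention and the bound is
  trivial. This spares the averaging argument a separate integrability check at each point.\<close>

lemma ennreal_norm_integral_le:
  fixes f :: "'a \<Rightarrow> 'b::{banach, second_countable_topology}"
  shows "ennreal (norm (integral\<^sup>L M f)) \<le> (\<integral>\<^sup>+x. ennreal (norm (f x)) \<partial>M)"
proof (cases "integrable M f")
  case True
  then show ?thesis by (rule integral_norm_bound_ennreal)
qed (simp add: not_integrable_integral_eq)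

text \<open>Jensen's inequality for the probability density \<open>k\<close>, followed by Tonelli.\<close>

lemma L2_average:
  fixes F :: "'a::euclidean_space \<Rightarrow> 'a \<Rightarrow> complex"
  assumes k: "test_function k" "\<And>z. 0 \<le> k z" "(LINT z|lborel. k z) = 1"
    and F: "case_prod F \<in> borel_measurable (borel \<Otimes>\<^sub>M borel)"
    and e: "0 \<le> e" "\<And>z. k z \<noteq> 0 \<Longrightarrow> (\<lambda>x. F x z) \<in> L2 \<and> L2_norm (\<lambda>x. F x z) \<le> e"
  shows "(\<lambda>x. LINT z|lborel. k z *\<^sub>R F x z) \<in> L2"
    and "L2_norm (\<lambda>x. LINT z|lborel. k z *\<^sub>R F x z) \<le> e"
proof -
  have [measurable]: "k \<in> borel_measurable borel" using k(1) by (rule test_function_borel)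
  have F'[measurable]: "case_prod F \<in> borel_measurable (lborel \<Otimes>\<^sub>M lborel)"
    using F by (simp cong: measurable_cong_sets add: measurable_cong_sets[OF sets_pair_measure_cong[OF sets_lborel sets_lborel] refl])
  have kint: "(\<integral>\<^sup>+z. ennreal (k z) \<partial>lborel) = 1"
    using k test_function_integrable(1)[OF k(1)] by (subst nn_integral_eq_integral) auto
  let ?G = "\<lambda>x. LINT z|lborel. k z *\<^sub>R F x z"
  have "?G \<in> borel_measurable lborel" by measurable
  then have G: "?G \<in> borel_measurable lebesgue" by (rule measurable_completion)
  have pointwise: "ennreal ((norm (?G x))\<^sup>2) \<le> (\<integral>\<^sup>+z. ennreal (k z * (norm (F x z))\<^sup>2) \<partial>lborel)" for x
  proof -
    have "ennreal ((norm (?G x))\<^sup>2) = (ennreal (norm (?G x)))\<^sup>2" by (simp add: ennreal_power)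
    also have "\<dots> \<le> (\<integral>\<^sup>+z. ennreal (norm (k z *\<^sub>R F x z)) \<partial>lborel)\<^sup>2"
      by (intro power_mono ennreal_norm_integral_le) auto
    \<comment> \<open>The kernel is split as sqrt k times sqrt k, so that in the Cauchy-Schwarz
      inequality the first factor integrates to 1 and the second carries the weight k.\<close>
    also have "(\<integral>\<^sup>+z. ennreal (norm (k z *\<^sub>R F x z)) \<partial>lborel) =
        (\<integral>\<^sup>+z. ennreal (sqrt (k z)) * ennreal (sqrt (k z) * norm (F x z)) \<partial>lborel)"
      using k(2) by (intro nn_integral_cong) (simp add: ennreal_mult'[symmetric] mult.assoc[symmetric])
    also have "(\<dots>)\<^sup>2 \<le> (\<integral>\<^sup>+z. (ennreal (sqrt (k z)))\<^sup>2 \<partial>lborel) *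
        (\<integral>\<^sup>+z. (ennreal (sqrt (k z) * norm (F x z)))\<^sup>2 \<partial>lborel)"
      by (rule Cauchy_Schwarz_nn_integral) measurable
    also have "\<dots> = (\<integral>\<^sup>+z. ennreal (k z * (norm (F x z))\<^sup>2) \<partial>lborel)"
      using k(2) kint by (simp add: ennreal_power power_mult_distrib)
    finally show ?thesis .
  qed
  have "(\<integral>\<^sup>+x. ennreal ((norm (?G x))\<^sup>2) \<partial>lebesgue) = (\<integral>\<^sup>+x. ennreal ((norm (?G x))\<^sup>2) \<partial>lborel)"
    by (rule nn_integral_completion)
  also have "\<dots> \<le> (\<integral>\<^sup>+x. (\<integral>\<^sup>+z. ennreal (k z * (norm (F x z))\<^sup>2) \<partial>lborel) \<partial>lborel)"
    by (intro nn_integral_mono pointwise)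
  also have "\<dots> = (\<integral>\<^sup>+z. (\<integral>\<^sup>+x. ennreal (k z * (norm (F x z))\<^sup>2) \<partial>lborel) \<partial>lborel)"
    by (rule lborel_pair.Fubini'[symmetric]) measurable
  also have "\<dots> \<le> (\<integral>\<^sup>+z. ennreal (k z) * ennreal (e\<^sup>2) \<partial>lborel)"
  proof (rule nn_integral_mono)
    fix z :: 'a
    show "(\<integral>\<^sup>+x. ennreal (k z * (norm (F x z))\<^sup>2) \<partial>lborel) \<le> ennreal (k z) * ennreal (e\<^sup>2)"
    proof (cases "k z = 0")
      case False
      have "(\<integral>\<^sup>+x. ennreal (k z * (norm (F x z))\<^sup>2) \<partial>lborel) =
          ennreal (k z) * (\<integral>\<^sup>+x. ennreal ((norm (F x z))\<^sup>2) \<partial>lborel)"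
        using k(2) by (simp add: ennreal_mult' nn_integral_cmult)
      also have "(\<integral>\<^sup>+x. ennreal ((norm (F x z))\<^sup>2) \<partial>lborel) = ennreal ((L2_norm (\<lambda>x. F x z))\<^sup>2)"
        using e(2)[OF False] by (subst L2_nn_integral[symmetric]) (auto simp: nn_integral_completion)
      also have "\<dots> \<le> ennreal (e\<^sup>2)" using e(2)[OF False] by (intro ennreal_leI power_mono) auto
      finally show ?thesis by (simp add: mult_left_mono)
    qed simp
  qed
  also have "\<dots> = ennreal (e\<^sup>2)" by (simp add: nn_integral_multc kint)
  finally have le: "(\<integral>\<^sup>+x. ennreal ((norm (?G x))\<^sup>2) \<partial>lebesgue) \<le> ennreal (e\<^sup>2)" .
  show "?G \<in> L2" "L2_norm ?G \<le> e" using L2_I_nn_integral[OF G e(1) le] by auto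
qed

lemma convolve_borel:
  fixes f :: "'a::euclidean_space \<Rightarrow> 'b::{banach, second_countable_topology}"
  assumes [measurable]: "f \<in> borel_measurable borel" "k \<in> borel_measurable borel"
  shows "convolve f k x = (LINT z|lborel. k z *\<^sub>R f (x - z))"
proof -
  have "convolve f k x = (LINT y|lborel. k (x - y) *\<^sub>R f y)"
    unfolding convolve_def by (rule integral_completion) measurable
  also have "\<dots> = (LINT z|lborel. k z *\<^sub>R f (x - z))"
    by (subst lborel_integral_affine[where c = "-1" and t = x]) auto
  finally show ?thesis .
qed

text \<open>Each value of the convolution is an integral, blind to null sets, so equality holds at
  every x and not just almost everywhere.\<close>

lemma convolve_cong_AE:
  fixes f g :: "'a::euclidean_space \<Rightarrow> 'b::{banach, second_countable_topology}"
  assumes "AE x in lebesgue. f x = g x" "test_function k"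
    and [measurable]: "f \<in> borel_measurable lebesgue" "g \<in> borel_measurable lebesgue"
  shows "convolve f k = convolve g k"
proof
  fix x
  have "test_function (\<lambda>y. 1 * k (x + (-1) *\<^sub>R y))"
    using assms(2) by (rule test_function_affine) simp
  then have "test_function (\<lambda>y. k (x - y))" by simp
  then have [measurable]: "(\<lambda>y. k (x - y)) \<in> borel_measurable lebesgue" by (rule test_function_measurable)
  show "convolve f k x = convolve g k x"
    unfolding convolve_def using assms(1) by (intro integral_cong_AE) (auto elim: eventually_mono)
qed

lemma convolve_kernel_integrable:
  assumes "test_function k" "f \<in> borel_measurable borel" "f \<in> L2"
  shows "integrable lborel (\<lambda>z. k z *\<^sub>R f (x - z))"
proof -
  have [measurable]: "f \<in> borel_measurable borel" "k \<in> borel_measurable borel"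
    using assms test_function_borel by auto
  have "integrable lborel (\<lambda>z. (norm (f (x + (-1) *\<^sub>R z)))\<^sup>2)"
    using assms by (intro lborel_integrable_affine[of "\<lambda>x. (norm (f x))\<^sup>2"]) (auto simp: borel_L2_iff)
  then have "(\<lambda>z. f (x - z)) \<in> L2" by (subst borel_L2_iff) auto
  from test_function_mult_L2_integrable[OF assms(1) this] show ?thesis
    by (subst (asm) integrable_completion) auto
qed

lemma mollify_borel:
  assumes k: "test_function k" "\<And>z. 0 \<le> k z" "(LINT z|lborel. k z) = 1"
    and f: "f \<in> borel_measurable borel" "f \<in> L2"
    and e: "0 \<le> e" "\<And>h. k h \<noteq> 0 \<Longrightarrow> L2_norm (\<lambda>x. f (x - h) - f x) \<le> e"
  shows "(\<lambda>x. convolve f k x - f x) \<in> L2" "L2_norm (\<lambda>x. convolve f k x - f x) \<le> e"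
proof -
  have [measurable]: "f \<in> borel_measurable borel" "k \<in> borel_measurable borel"
    using f k test_function_borel by auto
  \<comment> \<open>Because k has mass 1, f x is itself the k-average of a constant and can be taken
    under the integral.\<close>
  have eq: "convolve f k x - f x = (LINT z|lborel. k z *\<^sub>R (f (x - z) - f x))" for x
  proof -
    have "(LINT z|lborel. k z *\<^sub>R (f (x - z) - f x)) =
        (LINT z|lborel. k z *\<^sub>R f (x - z)) - (LINT z|lborel. k z *\<^sub>R f x)"
      unfolding scaleR_diff_right using convolve_kernel_integrable[OF k(1) f] test_function_integrable(1)[OF k(1)]
      by (intro Bochner_Integration.integral_diff) auto
    also have "\<dots> = convolve f k x - f x"
      using k(3) test_function_integrable(1)[OF k(1)] by (simp add: convolve_borel)
    finally show ?thesis by simp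
  qed
  have "(\<lambda>(x, z). f (x - z) - f x) \<in> borel_measurable (borel \<Otimes>\<^sub>M borel)" by measurable
  note * = L2_average[OF k this e(1)]
  have "(\<lambda>x. f (x - z) - f x) \<in> L2" for z by (intro L2_diff L2_translate f)
  then show "(\<lambda>x. convolve f k x - f x) \<in> L2" "L2_norm (\<lambda>x. convolve f k x - f x) \<le> e"
    unfolding eq using * e(2) by auto
qed

lemma mollify_potential_borel:
  fixes q :: "'a::euclidean_space \<Rightarrow> real"
  assumes k: "test_function k" "\<And>z. 0 \<le> k z" "(LINT z|lborel. k z) = 1"
    and q: "q \<in> borel_measurable borel" "\<And>x. \<bar>q x\<bar> \<le> C"
    and u: "u \<in> borel_measurable borel" "u \<in> L2"
    and e: "0 \<le> e" "\<And>h. k h \<noteq> 0 \<Longrightarrow> L2_norm (\<lambda>x. (q (x - h) - q x) *\<^sub>R u x) \<le> e"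
  shows "L2_norm (\<lambda>x. (convolve q k x - q x) *\<^sub>R u x) \<le> e"
proof -
  have [measurable]: "q \<in> borel_measurable borel" "u \<in> borel_measurable borel" "k \<in> borel_measurable borel"
    using q u k test_function_borel by auto
  \<comment> \<open>Here the potential is only bounded, not square integrable, so integrability has
    to come from the kernel.\<close>
  have int: "integrable lborel (\<lambda>z. k z * q (x - z))" for x
  proof (rule Bochner_Integration.integrable_bound)
    show "integrable lborel (\<lambda>z. C * \<bar>k z\<bar>)" using test_function_integrable(3)[OF k(1)] by auto
    show "AE z in lborel. norm (k z * q (x - z)) \<le> norm (C * \<bar>k z\<bar>)"
    proof (rule AE_I2)
      fix z
      have "\<bar>k z\<bar> * \<bar>q (x - z)\<bar> \<le> \<bar>k z\<bar> * \<bar>C\<bar>"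
        using q(2)[of "x - z"] by (intro mult_left_mono) auto
      then show "norm (k z * q (x - z)) \<le> norm (C * \<bar>k z\<bar>)" by (simp add: abs_mult mult.commute)
    qed
  qed measurable
  have eq: "(convolve q k x - q x) *\<^sub>R u x = (LINT z|lborel. k z *\<^sub>R ((q (x - z) - q x) *\<^sub>R u x))" for x
  proof -
    have ki: "integrable lborel (\<lambda>z. k z * q x)" using test_function_integrable(1)[OF k(1)] by auto
    have "(LINT z|lborel. k z *\<^sub>R ((q (x - z) - q x) *\<^sub>R u x)) =
        (LINT z|lborel. (k z * q (x - z) - k z * q x) *\<^sub>R u x)"
      by (simp add: algebra_simps)
    also have "\<dots> = (LINT z|lborel. k z * q (x - z) - k z * q x) *\<^sub>R u x"
      using int ki by (intro integral_scaleR_left) auto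
    also have "(LINT z|lborel. k z * q (x - z) - k z * q x) =
        (LINT z|lborel. k z * q (x - z)) - (LINT z|lborel. k z * q x)"
      using int ki by (rule Bochner_Integration.integral_diff)
    also have "\<dots> = convolve q k x - q x"
      using k(3) by (simp add: convolve_borel)
    finally show ?thesis by simp
  qed
  have "(\<lambda>(x, z). (q (x - z) - q x) *\<^sub>R u x) \<in> borel_measurable (borel \<Otimes>\<^sub>M borel)" by measurable
  note * = L2_average(2)[OF k this e(1)]
  have "(\<lambda>x. (q (x - z) - q x) *\<^sub>R u x) \<in> L2" for z
  proof (rule L2_bounded_mult[OF u(2)])
    show "AE x in lebesgue. \<bar>q (x - z) - q x\<bar> \<le> 2 * C"
    proof (rule AE_I2)
      fix x show "\<bar>q (x - z) - q x\<bar> \<le> 2 * C" using q(2)[of x] q(2)[of "x - z"] by simp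
    qed
    show "(\<lambda>x. q (x - z) - q x) \<in> borel_measurable lebesgue" by (intro measurable_completion) simp
  qed
  then show ?thesis unfolding eq using * e(2) by auto
qed

lemma L2_shift_potential_tendsto:
  fixes q :: "'a::euclidean_space \<Rightarrow> real"
  assumes q: "q \<in> borel_measurable borel" "\<And>x. \<bar>q x\<bar> \<le> C"
    and u: "u \<in> borel_measurable borel" "u \<in> L2"
  shows "((\<lambda>h. L2_norm (\<lambda>x. (q (x - h) - q x) *\<^sub>R u x)) \<longlongrightarrow> 0) (at 0)"
proof -
  have [measurable]: "q \<in> borel_measurable borel" "u \<in> borel_measurable borel"
    using q u by auto
  have [measurable]: "(\<lambda>x. q (x - h)) \<in> borel_measurable lebesgue" for h
    by (intro measurable_completion) simp
  have C: "0 \<le> C" using q(2)[of 0] by simp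
  have ql: "q \<in> borel_measurable lebesgue" by (intro measurable_completion) simp
  have qu: "(\<lambda>x. q x *\<^sub>R u x) \<in> L2"
    by (rule L2_bounded_mult[OF u(2) ql, of C]) (auto simp: q(2))
  let ?B = "\<lambda>h. C * L2_norm (\<lambda>x. u (x - h) - u x) + L2_norm (\<lambda>x. q (x - h) *\<^sub>R u (x - h) - q x *\<^sub>R u x)"
  have le: "L2_norm (\<lambda>x. (q (x - h) - q x) *\<^sub>R u x) \<le> ?B h" for h
  proof -
    have d: "(\<lambda>x. u x - u (x - h)) \<in> L2" by (intro L2_diff L2_translate u)
    have 1: "(\<lambda>x. q (x - h) *\<^sub>R (u x - u (x - h))) \<in> L2"
      by (rule L2_bounded_mult[OF d, of _ C]) (auto simp: q(2))
    have 2: "(\<lambda>x. q (x - h) *\<^sub>R u (x - h) - q x *\<^sub>R u x) \<in> L2"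
      using qu by (intro L2_diff L2_translate[of "\<lambda>x. q x *\<^sub>R u x"]) auto
    have "L2_norm (\<lambda>x. (q (x - h) - q x) *\<^sub>R u x) =
      L2_norm (\<lambda>x. q (x - h) *\<^sub>R (u x - u (x - h)) + (q (x - h) *\<^sub>R u (x - h) - q x *\<^sub>R u x))"
      by (simp add: algebra_simps)
    also have "\<dots> \<le> L2_norm (\<lambda>x. q (x - h) *\<^sub>R (u x - u (x - h))) +
        L2_norm (\<lambda>x. q (x - h) *\<^sub>R u (x - h) - q x *\<^sub>R u x)"
      using 1 2 by (rule L2_norm_triangle)
    also have "L2_norm (\<lambda>x. q (x - h) *\<^sub>R (u x - u (x - h))) \<le> C * L2_norm (\<lambda>x. u x - u (x - h))"
      using C by (intro L2_norm_bounded_mult_le d) (auto simp: q(2))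
    finally show ?thesis by (simp add: L2_norm_minus_commute[of u])
  qed
  have "(?B \<longlongrightarrow> C * 0 + 0) (at 0)"
    using L2_shift_tendsto[of "\<lambda>x. q x *\<^sub>R u x"] qu
    by (intro tendsto_add tendsto_mult_left L2_shift_tendsto u) auto
  then have "(?B \<longlongrightarrow> 0) (at 0)" by simp
  then show ?thesis
    by (rule Lim_null_comparison[rotated]) (rule always_eventually, simp add: le)
qed

section \<open>Concentration of the rescaled kernels at the origin\<close>

lemma scaled_mollifier:
  fixes \<psi> :: "'a::euclidean_space \<Rightarrow> real"
  assumes "friedrichs_mollifier \<psi>" "0 < r"
  shows "test_function (scaled \<psi> r)" "0 \<le> scaled \<psi> r x" "(LINT x|lborel. scaled \<psi> r x) = 1"
proof -
  have t: "test_function \<psi>" using assms(1) by (simp add: friedrichs_mollifier_def)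
  have [measurable]: "\<psi> \<in> borel_measurable borel" using t by (rule test_function_borel)
  have eq: "scaled \<psi> r = (\<lambda>x. (1 / r ^ DIM('a)) * \<psi> (0 + (1 / r) *\<^sub>R x))"
    by (simp add: scaled_def fun_eq_iff inverse_eq_divide)
  show "test_function (scaled \<psi> r)"
    unfolding eq using t assms(2) by (intro test_function_affine) auto
  show "0 \<le> scaled \<psi> r x"
    using assms by (simp add: scaled_def friedrichs_mollifier_def)
  have "1 = (LINT x|lborel. \<psi> x)"
    using assms(1) by (simp add: friedrichs_mollifier_def integral_completion)
  also have "\<dots> = \<bar>1 / r\<bar> ^ DIM('a) *\<^sub>R (LINT x|lborel. \<psi> (0 + (1 / r) *\<^sub>R x))"
    using assms(2) by (intro lborel_integral_affine) auto
  also have "\<dots> = (LINT x|lborel. scaled \<psi> r x)"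
    using assms(2) by (simp add: eq power_divide)
  finally show "(LINT x|lborel. scaled \<psi> r x) = 1" by simp
qed

text \<open>If \<psi> vanishes outside the ball of radius R, the rescaled kernel vanishes outside
  that of radius R r; hence the threshold r < d / R.\<close>

lemma scaled_support_small:
  fixes \<psi> :: "'a::euclidean_space \<Rightarrow> real"
  assumes "test_function \<psi>" "0 < d"
  shows "\<forall>\<^sub>F r in at_right 0. 0 < r \<and> (\<forall>h. scaled \<psi> r h \<noteq> 0 \<longrightarrow> norm h < d)"
proof -
  have "bounded {x. \<psi> x \<noteq> 0}"
    using assms(1) by (simp add: test_function_def compact_closure)
  then obtain R where R: "0 < R" "\<And>x. \<psi> x \<noteq> 0 \<Longrightarrow> norm x \<le> R"
    by (auto simp: bounded_pos)
  have "\<forall>\<^sub>F r in at_right 0. r \<in> {0<..<d / R}"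
    using assms(2) R(1) by (intro eventually_at_right_real) auto
  then show ?thesis
  proof eventually_elim
    case (elim r)
    have "norm h < d" if "scaled \<psi> r h \<noteq> 0" for h
    proof -
      have "norm (h /\<^sub>R r) \<le> R" using that by (intro R(2)) (auto simp: scaled_def)
      then have "norm h \<le> R * r" using elim by (simp add: field_simps)
      also have "\<dots> < d" using elim R(1) by (simp add: field_simps)
      finally show ?thesis .
    qed
    then show ?case using elim by auto
  qed
qed

text \<open>The limit at 0 says nothing about the shift h = 0, where the kernel may well be nonzero;
  the condition S 0 = 0 fills that gap.\<close>

lemma eventually_scaled_shift_le:
  fixes \<psi> :: "'a::euclidean_space \<Rightarrow> real" and S :: "'a \<Rightarrow> real"
  assumes "test_function \<psi>" "(S \<longlongrightarrow> 0) (at 0)" "S 0 = 0" "0 < e"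
  shows "\<forall>\<^sub>F r in at_right 0. 0 < r \<and> (\<forall>h. scaled \<psi> r h \<noteq> 0 \<longrightarrow> S h \<le> e)"
proof -
  have "\<forall>\<^sub>F h in at 0. S h < e" using assms(2,4) by (intro order_tendstoD(2)) auto
  then obtain d where d: "0 < d" "\<And>h. h \<noteq> 0 \<Longrightarrow> norm h < d \<Longrightarrow> S h < e"
    by (auto simp: eventually_at)
  then have "S h \<le> e" if "norm h < d" for h
    using that assms(3,4) by (cases "h = 0") (auto intro: less_imp_le)
  with scaled_support_small[OF assms(1) d(1)] show ?thesis
    by (auto elim!: eventually_mono)
qed

text \<open>\<open>L2_norm\<close> is 0 on a function whose square is not integrable, so a limit of
  norms alone would carry little information; the second conclusion secures membership, which the
  linearity and Cauchy-Schwarz rules require.\<close>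

lemma mollify_tendsto:
  fixes f :: "'a::euclidean_space \<Rightarrow> complex"
  assumes \<psi>: "friedrichs_mollifier \<psi>" and f: "f \<in> L2"
  shows "((\<lambda>r. L2_norm (\<lambda>x. convolve f (scaled \<psi> r) x - f x)) \<longlongrightarrow> 0) (at_right 0)"
    and "\<forall>\<^sub>F r in at_right 0. convolve f (scaled \<psi> r) \<in> L2"
proof -
  have t: "test_function \<psi>" using \<psi> by (simp add: friedrichs_mollifier_def)
  obtain g where g: "g \<in> borel_measurable borel" "AE x in lebesgue. f x = g x"
    using L2_borel_version[OF L2_measurable[OF f]] .
  have gl: "g \<in> borel_measurable lebesgue" using g(1) by (intro measurable_completion) auto
  have gL: "g \<in> L2" using L2_cong_AE[OF g(2) f gl] .
  have *: "\<forall>\<^sub>F r in at_right 0. convolve f (scaled \<psi> r) \<in> L2 \<and>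
      L2_norm (\<lambda>x. convolve f (scaled \<psi> r) x - f x) \<le> e" if "0 < e" for e
    using eventually_scaled_shift_le[OF t L2_shift_tendsto[OF g(1) gL] _ that]
  proof (rule eventually_mono)
    fix r
    assume r: "0 < r \<and> (\<forall>h. scaled \<psi> r h \<noteq> 0 \<longrightarrow> L2_norm (\<lambda>x. g (x - h) - g x) \<le> e)"
    note k = scaled_mollifier[OF \<psi>, of r]
    have eq: "convolve f (scaled \<psi> r) = convolve g (scaled \<psi> r)"
      using r by (intro convolve_cong_AE g(2) k L2_measurable[OF f] gl) auto
    have D: "(\<lambda>x. convolve g (scaled \<psi> r) x - g x) \<in> L2"
      "L2_norm (\<lambda>x. convolve g (scaled \<psi> r) x - g x) \<le> e"
      using r that by (intro mollify_borel k g(1) gL; auto)+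
    have cL: "convolve g (scaled \<psi> r) \<in> L2" using L2_add[OF D(1) gL] by simp
    have "L2_norm (\<lambda>x. convolve f (scaled \<psi> r) x - f x) = L2_norm (\<lambda>x. convolve g (scaled \<psi> r) x - g x)"
      unfolding eq
    proof (rule L2_norm_cong_AE)
      show "AE x in lebesgue. convolve g (scaled \<psi> r) x - f x = convolve g (scaled \<psi> r) x - g x"
        using g(2) by eventually_elim simp
    qed (use cL f gL in \<open>auto intro!: L2_diff L2_measurable\<close>)
    with D cL eq show "convolve f (scaled \<psi> r) \<in> L2 \<and> L2_norm (\<lambda>x. convolve f (scaled \<psi> r) x - f x) \<le> e"
      by simp
  qed (simp add: L2_norm_def)
  show "\<forall>\<^sub>F r in at_right 0. convolve f (scaled \<psi> r) \<in> L2"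
    using *[of 1] by (auto elim: eventually_mono)
  show "((\<lambda>r. L2_norm (\<lambda>x. convolve f (scaled \<psi> r) x - f x)) \<longlongrightarrow> 0) (at_right 0)"
  proof (rule tendstoI)
    fix e :: real assume "0 < e"
    then show "\<forall>\<^sub>F r in at_right 0. dist (L2_norm (\<lambda>x. convolve f (scaled \<psi> r) x - f x)) 0 < e"
      using *[of "e / 2"] by (auto elim!: eventually_mono)
  qed
qed

section \<open>Essentially bounded potentials and their mollification\<close>

lemma Linf_bounded:
  assumes "q \<in> Linf"
  obtains C where "0 \<le> C" "AE x in lebesgue. \<bar>q x\<bar> \<le> C"
proof -
  let ?E = "esssup lebesgue (\<lambda>x. ereal \<bar>q x\<bar>)"
  have fin: "?E < \<infinity>" using assms by (simp add: Linf_def)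
  \<comment> \<open>The maximum with 0 makes the constant nonnegative without a discussion of the
    sign of the essential supremum.\<close>
  have "AE x in lebesgue. \<bar>q x\<bar> \<le> max 0 (real_of_ereal ?E)"
    using esssup_AE[where M = lebesgue and f = "\<lambda>x. ereal \<bar>q x\<bar>"]
  proof eventually_elim
    case (elim x)
    then show ?case using fin by (cases ?E) auto
  qed
  then show thesis by (intro that) auto
qed

text \<open>Truncation to [-C, C] changes the function only on a null set and turns the
  almost-everywhere bound into one at every point.\<close>

lemma Linf_borel_version:
  fixes q :: "'a::euclidean_space \<Rightarrow> real"
  assumes "q \<in> borel_measurable lebesgue" "AE x in lebesgue. \<bar>q x\<bar> \<le> C" "0 \<le> C"
  obtains p where "p \<in> borel_measurable borel" "AE x in lebesgue. q x = p x" "\<And>x. \<bar>p x\<bar> \<le> C"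
proof -
  from completion_ex_borel_measurable_real[OF assms(1)] obtain a
    where a: "a \<in> borel_measurable lborel" "AE x in lborel. q x = a x" by auto
  have [measurable]: "a \<in> borel_measurable borel" using a by auto
  show thesis
  proof
    show "(\<lambda>x. max (- C) (min C (a x))) \<in> borel_measurable borel" by measurable
    show "AE x in lebesgue. q x = max (- C) (min C (a x))"
      using AE_completion[OF a(2)] assms(2) by eventually_elim auto
    show "\<bar>max (- C) (min C (a x))\<bar> \<le> C" for x using assms(3) by auto
  qed
qed

text \<open>Averaging against a probability density cannot exceed the bound. The point is that C
  does not depend on the kernel, which makes all regularised potentials uniformly bounded.\<close>

lemma convolve_bounded:
  fixes q :: "'a::euclidean_space \<Rightarrow> real"
  assumes k: "test_function k" "\<And>z. 0 \<le> k z" "(LINT z|lborel. k z) = 1"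
    and q: "q \<in> borel_measurable lebesgue" "AE x in lebesgue. \<bar>q x\<bar> \<le> C" "0 \<le> C"
  shows "\<bar>convolve q k x\<bar> \<le> C" "convolve q k \<in> borel_measurable lebesgue"
proof -
  obtain p where p: "p \<in> borel_measurable borel" "AE x in lebesgue. q x = p x" "\<And>x. \<bar>p x\<bar> \<le> C"
    using Linf_borel_version[OF q] by blast
  have [measurable]: "p \<in> borel_measurable borel" "k \<in> borel_measurable borel"
    using p k test_function_borel by auto
  have pl: "p \<in> borel_measurable lebesgue" by (intro measurable_completion) simp
  have eq: "convolve q k = (\<lambda>x. LINT z|lborel. k z *\<^sub>R p (x - z))"
    using convolve_cong_AE[OF p(2) k(1) q(1) pl] by (simp add: fun_eq_iff convolve_borel)
  have "(\<lambda>x. LINT z|lborel. k z *\<^sub>R p (x - z)) \<in> borel_measurable lborel" by measurable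
  then show "convolve q k \<in> borel_measurable lebesgue" unfolding eq by (rule measurable_completion)
  have "norm (LINT z|lborel. k z *\<^sub>R p (x - z)) \<le> (LINT z|lborel. C * k z)"
  proof (rule Bochner_Integration.integral_norm_bound_integral)
    show le: "norm (k z *\<^sub>R p (x - z)) \<le> C * k z" for z
      using mult_left_mono[OF p(3)[of "x - z"] k(2)[of z]] k(2)[of z] by (simp add: abs_mult mult.commute)
    show "integrable lborel (\<lambda>z. C * k z)" using test_function_integrable(1)[OF k(1)] by auto
    then show "integrable lborel (\<lambda>z. k z *\<^sub>R p (x - z))"
      by (rule Bochner_Integration.integrable_bound) (use le in \<open>auto intro: order_trans[OF _ abs_ge_self]\<close>)
  qed
  then show "\<bar>convolve q k x\<bar> \<le> C" using k(3) by (simp add: eq)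
qed

lemma mollify_potential_tendsto:
  fixes q :: "'a::euclidean_space \<Rightarrow> real"
  assumes \<psi>: "friedrichs_mollifier \<psi>"
    and q: "q \<in> borel_measurable lebesgue" "AE x in lebesgue. \<bar>q x\<bar> \<le> C" "0 \<le> C" and u: "u \<in> L2"
  shows "((\<lambda>r. L2_norm (\<lambda>x. (convolve q (scaled \<psi> r) x - q x) *\<^sub>R u x)) \<longlongrightarrow> 0) (at_right 0)"
proof -
  have t: "test_function \<psi>" using \<psi> by (simp add: friedrichs_mollifier_def)
  obtain p where p: "p \<in> borel_measurable borel" "AE x in lebesgue. q x = p x" "\<And>x. \<bar>p x\<bar> \<le> C"
    using Linf_borel_version[OF q] by blast
  have pl: "p \<in> borel_measurable lebesgue" using p(1) by (intro measurable_completion) auto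
  obtain v where v: "v \<in> borel_measurable borel" "AE x in lebesgue. u x = v x"
    using L2_borel_version[OF L2_measurable[OF u]] .
  have vl: "v \<in> borel_measurable lebesgue" using v(1) by (intro measurable_completion) auto
  have vL: "v \<in> L2" using L2_cong_AE[OF v(2) u vl] .
  have *: "\<forall>\<^sub>F r in at_right 0. L2_norm (\<lambda>x. (convolve q (scaled \<psi> r) x - q x) *\<^sub>R u x) \<le> e" if "0 < e" for e
    using eventually_scaled_shift_le[OF t L2_shift_potential_tendsto[OF p(1,3) v(1) vL] _ that]
  proof (rule eventually_mono)
    fix r
    assume r: "0 < r \<and> (\<forall>h. scaled \<psi> r h \<noteq> 0 \<longrightarrow> L2_norm (\<lambda>x. (p (x - h) - p x) *\<^sub>R v x) \<le> e)"
    then have "0 < r" by simp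
    note k = scaled_mollifier[OF \<psi> this]
    have eq: "convolve q (scaled \<psi> r) = convolve p (scaled \<psi> r)"
      by (intro convolve_cong_AE p(2) k q(1) pl)
    have cm: "convolve p (scaled \<psi> r) \<in> borel_measurable lebesgue"
      using convolve_bounded(2)[OF k q] by (simp add: eq)
    have "L2_norm (\<lambda>x. (convolve q (scaled \<psi> r) x - q x) *\<^sub>R u x) =
        L2_norm (\<lambda>x. (convolve p (scaled \<psi> r) x - p x) *\<^sub>R v x)"
      unfolding eq
    proof (rule L2_norm_cong_AE)
      show "AE x in lebesgue. (convolve p (scaled \<psi> r) x - q x) *\<^sub>R u x = (convolve p (scaled \<psi> r) x - p x) *\<^sub>R v x"
        using p(2) v(2) by eventually_elim simp
    qed (use cm L2_measurable[OF u] vl q(1) pl in auto)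
    also have "\<dots> \<le> e"
      using r that by (intro mollify_potential_borel[OF k p(1,3) v(1) vL]) auto
    finally show "L2_norm (\<lambda>x. (convolve q (scaled \<psi> r) x - q x) *\<^sub>R u x) \<le> e" .
  qed (simp add: L2_norm_def)
  show ?thesis
  proof (rule tendstoI)
    fix e :: real assume "0 < e"
    then show "\<forall>\<^sub>F r in at_right 0. dist (L2_norm (\<lambda>x. (convolve q (scaled \<psi> r) x - q x) *\<^sub>R u x)) 0 < e"
      using *[of "e / 2"] by (auto elim!: eventually_mono)
  qed
qed

section \<open>The Dirichlet form of the weak Laplacian\<close>

lemma test_function_reflect:
  assumes "test_function k"
  shows "test_function (\<lambda>y. k (x - y))" "test_function (\<lambda>y. k (- y))"
  using test_function_affine[OF assms, of "-1" 1 x] test_function_affine[OF assms, of "-1" 1 0] by auto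

text \<open>Majorants for Fubini. Integrating |k (x - y)| over y leaves the L1 norm of k for every
  x; the second form is the first one for the reflected kernel with the variables exchanged.\<close>

lemma kernel_pair_integrable:
  fixes h :: "'a::euclidean_space \<Rightarrow> real"
  assumes k: "test_function k" and h: "integrable lborel h"
  shows "integrable (lborel \<Otimes>\<^sub>M lborel) (\<lambda>(x, y). \<bar>k (x - y)\<bar> * h x)"
    and "integrable (lborel \<Otimes>\<^sub>M lborel) (\<lambda>(x, y). \<bar>k (x - y)\<bar> * h y)"
proof -
  have main: "integrable (lborel \<Otimes>\<^sub>M lborel) (\<lambda>(x, y). \<bar>k (x - y)\<bar> * h x)" if "test_function k" for k
  proof -
    have [measurable]: "k \<in> borel_measurable borel" "h \<in> borel_measurable borel"
      using test_function_borel[OF that] borel_measurable_integrable[OF h] by auto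
    have inner_int: "integrable lborel (\<lambda>y. \<bar>k (x - y)\<bar>)" for x
      using test_function_integrable(3)[OF test_function_reflect(1)[OF that]] .
    have K: "(LINT y|lborel. \<bar>k (x - y)\<bar>) = (LINT y|lborel. \<bar>k y\<bar>)" for x
      using lborel_integral_affine[of "\<lambda>y. \<bar>k y\<bar>" "-1" x] by simp
    show ?thesis
    proof (rule lborel_pair.Fubini_integrable)
      show "(\<lambda>(x, y). \<bar>k (x - y)\<bar> * h x) \<in> borel_measurable (lborel \<Otimes>\<^sub>M lborel)" by measurable
      show "integrable lborel (\<lambda>x. LINT y|lborel. norm (case (x, y) of (x, y) \<Rightarrow> \<bar>k (x - y)\<bar> * h x))"
        using h by (simp add: abs_mult K)
      show "AE x in lborel. integrable lborel (\<lambda>y. case (x, y) of (x, y) \<Rightarrow> \<bar>k (x - y)\<bar> * h x)"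
        using inner_int by simp
    qed
  qed
  show "integrable (lborel \<Otimes>\<^sub>M lborel) (\<lambda>(x, y). \<bar>k (x - y)\<bar> * h x)" using main[OF k] .
  have "integrable (lborel \<Otimes>\<^sub>M lborel) (\<lambda>(x, y). \<bar>k (- (x - y))\<bar> * h x)"
    using main[OF test_function_reflect(2)[OF k]] .
  from lborel_pair.integrable_product_swap[OF this]
  show "integrable (lborel \<Otimes>\<^sub>M lborel) (\<lambda>(x, y). \<bar>k (x - y)\<bar> * h y)"
    by (simp add: case_prod_unfold)
qed

text \<open>The adjoint of convolution with k is convolution with the reflected kernel, by Fubini.
  The product |v x| |g y| is at most |v x|^2 + |g y|^2, and each summand times |k (x - y)| is
  integrable on the product space.\<close>

lemma L2_inner_convolve_borel:
  fixes v g :: "'a::euclidean_space \<Rightarrow> complex"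
  assumes k: "test_function k"
    and v: "v \<in> borel_measurable borel" "v \<in> L2" and g: "g \<in> borel_measurable borel" "g \<in> L2"
  shows "integrable lebesgue (\<lambda>x. v x \<bullet> convolve g k x)"
    and "L2_inner v (convolve g k) = L2_inner g (convolve v (\<lambda>z. k (- z)))"
proof -
  have [measurable]: "k \<in> borel_measurable borel" "v \<in> borel_measurable borel" "g \<in> borel_measurable borel"
    using test_function_borel[OF k] v g by auto
  let ?f = "\<lambda>x y. k (x - y) * (v x \<bullet> g y)"
  have int: "integrable (lborel \<Otimes>\<^sub>M lborel) (case_prod ?f)"
  proof (rule Bochner_Integration.integrable_bound)
    show "integrable (lborel \<Otimes>\<^sub>M lborel)
        (\<lambda>p. (\<lambda>(x, y). \<bar>k (x - y)\<bar> * (norm (v x))\<^sup>2) p + (\<lambda>(x, y). \<bar>k (x - y)\<bar> * (norm (g y))\<^sup>2) p)"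
      using v g by (intro Bochner_Integration.integrable_add kernel_pair_integrable k) (auto simp: borel_L2_iff)
    show "AE p in lborel \<Otimes>\<^sub>M lborel. norm (case_prod ?f p) \<le>
        norm ((\<lambda>(x, y). \<bar>k (x - y)\<bar> * (norm (v x))\<^sup>2) p + (\<lambda>(x, y). \<bar>k (x - y)\<bar> * (norm (g y))\<^sup>2) p)"
    proof (rule AE_I2, clarify)
      fix x y
      have "\<bar>v x \<bullet> g y\<bar> \<le> norm (v x) * norm (g y)" by (rule Cauchy_Schwarz_ineq2)
      also have "\<dots> \<le> (norm (v x))\<^sup>2 + (norm (g y))\<^sup>2"
        using sum_squares_bound[of "norm (v x)" "norm (g y)"]
          mult_nonneg_nonneg[OF norm_ge_zero norm_ge_zero, of "v x" "g y"] by linarith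
      finally have "\<bar>k (x - y)\<bar> * \<bar>v x \<bullet> g y\<bar> \<le> \<bar>k (x - y)\<bar> * ((norm (v x))\<^sup>2 + (norm (g y))\<^sup>2)"
        by (rule mult_left_mono) simp
      also have "\<dots> \<le> \<bar>\<bar>k (x - y)\<bar> * (norm (v x))\<^sup>2 + \<bar>k (x - y)\<bar> * (norm (g y))\<^sup>2\<bar>"
        by (simp add: distrib_left)
      finally show "norm (k (x - y) * (v x \<bullet> g y)) \<le>
          norm (\<bar>k (x - y)\<bar> * (norm (v x))\<^sup>2 + \<bar>k (x - y)\<bar> * (norm (g y))\<^sup>2)"
        by (simp add: abs_mult)
    qed
  qed measurable
  have conv: "w \<bullet> convolve f l x = (LINT y|lborel. l (x - y) * (w \<bullet> f y))"
    if l: "test_function l" and f: "f \<in> borel_measurable borel" "f \<in> L2"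
    for w :: complex and f :: "'a \<Rightarrow> complex" and l x
  proof -
    have [measurable]: "f \<in> borel_measurable borel" "l \<in> borel_measurable borel"
      using f test_function_borel[OF l] by auto
    have "integrable lebesgue (\<lambda>y. l (x - y) *\<^sub>R f y)"
      by (rule test_function_mult_L2_integrable[OF test_function_reflect(1)[OF l] f(2)])
    then have i: "integrable lborel (\<lambda>y. l (x - y) *\<^sub>R f y)"
      by (subst (asm) integrable_completion) auto
    have "convolve f l x = (LINT y|lborel. l (x - y) *\<^sub>R f y)"
      unfolding convolve_def by (rule integral_completion) measurable
    then have "w \<bullet> convolve f l x = (LINT y|lborel. w \<bullet> (l (x - y) *\<^sub>R f y))"
      using integral_inner_right[OF i, of w] by (simp only:)
    then show ?thesis by simp
  qed
  have eq1: "v x \<bullet> convolve g k x = (LINT y|lborel. ?f x y)" for x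
    by (rule conv[OF k g])
  have eq2: "g y \<bullet> convolve v (\<lambda>z. k (- z)) y = (LINT x|lborel. ?f x y)" for y
    using conv[OF test_function_reflect(2)[OF k] v, of "g y" y] by (simp add: inner_commute)
  have m1: "(\<lambda>x. LINT y|lborel. ?f x y) \<in> borel_measurable lborel" by measurable
  have m2: "(\<lambda>y. LINT x|lborel. ?f x y) \<in> borel_measurable lborel" by measurable
  show "integrable lebesgue (\<lambda>x. v x \<bullet> convolve g k x)"
    unfolding eq1 using lborel_pair.integrable_fst[OF int] m1 by (subst integrable_completion) auto
  have "L2_inner v (convolve g k) = (LINT x|lborel. LINT y|lborel. ?f x y)"
    unfolding L2_inner_def eq1 using m1 by (rule integral_completion)
  also have "\<dots> = (LINT y|lborel. LINT x|lborel. ?f x y)"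
    using lborel_pair.Fubini_integral[OF int] by simp
  also have "\<dots> = L2_inner g (convolve v (\<lambda>z. k (- z)))"
    unfolding L2_inner_def eq2 using m2 by (rule integral_completion[symmetric])
  finally show "L2_inner v (convolve g k) = L2_inner g (convolve v (\<lambda>z. k (- z)))" .
qed

lemma convolve_measurable:
  fixes f :: "'a::euclidean_space \<Rightarrow> complex"
  assumes k: "test_function k" and f: "f \<in> borel_measurable lebesgue"
  shows "convolve f k \<in> borel_measurable lebesgue"
proof -
  obtain g where g: "g \<in> borel_measurable borel" "AE x in lebesgue. f x = g x"
    using L2_borel_version[OF f] .
  have [measurable]: "g \<in> borel_measurable borel" "k \<in> borel_measurable borel"
    using g test_function_borel[OF k] by auto
  have gl: "g \<in> borel_measurable lebesgue" by (intro measurable_completion) auto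
  have eq: "convolve f k = (\<lambda>x. LINT z|lborel. k z *\<^sub>R g (x - z))"
    using convolve_cong_AE[OF g(2) k f gl] by (simp add: fun_eq_iff convolve_borel)
  have "(\<lambda>x. LINT z|lborel. k z *\<^sub>R g (x - z)) \<in> borel_measurable lborel" by measurable
  then show ?thesis unfolding eq by (rule measurable_completion)
qed

lemma L2_inner_convolve:
  fixes v g :: "'a::euclidean_space \<Rightarrow> complex"
  assumes k: "test_function k" and v: "v \<in> L2" and g: "g \<in> L2"
  shows "integrable lebesgue (\<lambda>x. v x \<bullet> convolve g k x)"
    and "L2_inner v (convolve g k) = L2_inner g (convolve v (\<lambda>z. k (- z)))"
proof -
  obtain v' where v': "v' \<in> borel_measurable borel" "AE x in lebesgue. v x = v' x"
    using L2_borel_version[OF L2_measurable[OF v]] .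
  obtain g' where g': "g' \<in> borel_measurable borel" "AE x in lebesgue. g x = g' x"
    using L2_borel_version[OF L2_measurable[OF g]] .
  note k' = test_function_reflect(2)[OF k]
  have l: "v' \<in> borel_measurable lebesgue" "g' \<in> borel_measurable lebesgue"
    using v'(1) g'(1) by (auto intro!: measurable_completion)
  have L: "v' \<in> L2" "g' \<in> L2" using L2_cong_AE v v' g g' l by blast+
  note m = L2_measurable[OF v] L2_measurable[OF g]
  note cm = convolve_measurable[OF k l(2)] convolve_measurable[OF k' l(1)]
  have c: "convolve g k = convolve g' k" "convolve v (\<lambda>z. k (- z)) = convolve v' (\<lambda>z. k (- z))"
    using v' g' l m k k' by (auto intro!: convolve_cong_AE)
  note * = L2_inner_convolve_borel[OF k v'(1) L(1) g'(1) L(2)]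
  have "integrable lebesgue (\<lambda>x. v x \<bullet> convolve g' k x) = integrable lebesgue (\<lambda>x. v' x \<bullet> convolve g' k x)"
    by (rule integrable_cong_AE) (use v'(2) m l cm in \<open>auto elim: eventually_mono\<close>)
  with *(1) show "integrable lebesgue (\<lambda>x. v x \<bullet> convolve g k x)" by (simp add: c)
  have "L2_inner v (convolve g' k) = L2_inner v' (convolve g' k)"
    using v'(2) m l cm by (intro L2_inner_cong_AE) auto
  moreover have "L2_inner g (convolve v' (\<lambda>z. k (- z))) = L2_inner g' (convolve v' (\<lambda>z. k (- z)))"
    using g'(2) m l cm by (intro L2_inner_cong_AE) auto
  ultimately show "L2_inner v (convolve g k) = L2_inner g (convolve v (\<lambda>z. k (- z)))"
    using *(2) by (simp add: c)
qed

lemma partial_reflect: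
  assumes "test_function k"
  shows "partial b (\<lambda>y. k (x - y)) = (\<lambda>y. - partial b k (x - y))"
    and "partial b (\<lambda>y. k (- y)) = (\<lambda>y. - partial b k (- y))"
proof -
  have d: "k differentiable (at z)" for z
    using assms smooth_differentiable by (auto simp: test_function_def)
  show "partial b (\<lambda>y. k (x - y)) = (\<lambda>y. - partial b k (x - y))"
    using partial_affine(2)[OF d, of b 1 x "-1"] by (simp add: fun_eq_iff)
  show "partial b (\<lambda>y. k (- y)) = (\<lambda>y. - partial b k (- y))"
    using partial_affine(2)[OF d, of b 1 0 "-1"] by (simp add: fun_eq_iff)
qed

lemma partial_uminus:
  assumes "test_function k"
  shows "partial b (\<lambda>y. - k y) = (\<lambda>y. - partial b k y)"
proof -
  have d: "k differentiable (at z)" for z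
    using assms smooth_differentiable by (auto simp: test_function_def)
  show ?thesis using partial_affine(2)[OF d, of b "-1" 0 1] by (simp add: fun_eq_iff)
qed

text \<open>For fixed x the kernel y to k (x - y) is an admissible test function. The sign from
  differentiating the reflection cancels the sign in the definition of the weak derivative.\<close>

lemma convolve_weak_partial:
  assumes "has_weak_partial b f g" "test_function k"
  shows "convolve g k x = convolve f (partial b k) x"
proof -
  have "(LINT y|lebesgue. partial b (\<lambda>y. k (x - y)) y *\<^sub>R f y) = - (LINT y|lebesgue. k (x - y) *\<^sub>R g y)"
    using assms(1) test_function_reflect(1)[OF assms(2)] unfolding has_weak_partial_def by blast
  then show ?thesis
    unfolding partial_reflect(1)[OF assms(2)] convolve_def by simp
qed

lemma convolve_weak_laplacian:
  assumes "has_weak_laplacian f g" "test_function k"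
  shows "convolve g k x = (\<Sum>b\<in>Basis. convolve f (partial b (partial b k)) x)"
proof -
  have f: "f \<in> L2" using assms(1) by (simp add: has_weak_laplacian_def)
  \<comment> \<open>Each of the two derivatives contributes a factor -1 from the reflection, so the
    signs cancel.\<close>
  have pp: "partial b (partial b (\<lambda>y. k (x - y))) = (\<lambda>y. partial b (partial b k) (x - y))" if "b \<in> Basis" for b
    using partial_uminus[OF test_function_reflect(1)[OF test_function_partial[OF assms(2) that]], of b x]
      partial_reflect(1)[OF test_function_partial[OF assms(2) that], of b x]
    by (simp add: partial_reflect(1)[OF assms(2)])
  have "convolve g k x = (LINT y|lebesgue. k (x - y) *\<^sub>R g y)" by (simp add: convolve_def)
  also have "\<dots> = (LINT y|lebesgue. laplacian (\<lambda>y. k (x - y)) y *\<^sub>R f y)"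
    using assms(1) test_function_reflect(1)[OF assms(2)] unfolding has_weak_laplacian_def by auto
  also have "\<dots> = (LINT y|lebesgue. (\<Sum>b\<in>Basis. partial b (partial b k) (x - y) *\<^sub>R f y))"
    unfolding laplacian_def scaleR_sum_left by (intro Bochner_Integration.integral_cong sum.cong) (auto simp: pp)
  also have "\<dots> = (\<Sum>b\<in>Basis. LINT y|lebesgue. partial b (partial b k) (x - y) *\<^sub>R f y)"
    by (intro Bochner_Integration.integral_sum test_function_mult_L2_integrable f test_function_reflect test_function_partial assms)
  finally show ?thesis by (simp add: convolve_def)
qed

lemma convolve_uminus: "convolve f (\<lambda>z. - k z) x = - convolve f k x"
  by (simp add: convolve_def)

text \<open>
  All derivatives are moved onto the kernel, so no smoothness of the convolution, no cut-off and no
  density of test functions in \<open>H\<^sup>1\<close> is needed: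
  \<open>L * k = v * \<Delta>k = \<Sum>\<^sub>b g\<^sub>b * \<partial>\<^sub>b k\<close>, and Fubini carries the kernel \<open>\<partial>\<^sub>b k\<close> over to \<open>v\<close>.
\<close>

lemma convolved_dirichlet_form:
  fixes v :: "'a::euclidean_space \<Rightarrow> complex"
  assumes k: "test_function k" and L: "has_weak_laplacian v L"
    and g: "\<And>b. b \<in> Basis \<Longrightarrow> has_weak_partial b v (g b)"
  shows "L2_inner v (convolve L k) = - (\<Sum>b\<in>Basis. L2_inner (g b) (convolve (g b) (\<lambda>z. k (- z))))"
proof -
  have v: "v \<in> L2" using L by (simp add: has_weak_laplacian_def)
  have gL: "g b \<in> L2" if "b \<in> Basis" for b using g[OF that] by (simp add: has_weak_partial_def)
  have "convolve L k x = (\<Sum>b\<in>Basis. convolve (g b) (partial b k) x)" for x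
    unfolding convolve_weak_laplacian[OF L k]
    by (intro sum.cong refl convolve_weak_partial[symmetric] g test_function_partial k)
  then have "L2_inner v (convolve L k) = (LINT x|lebesgue. (\<Sum>b\<in>Basis. v x \<bullet> convolve (g b) (partial b k) x))"
    by (simp add: L2_inner_def inner_sum_right)
  also have "\<dots> = (\<Sum>b\<in>Basis. L2_inner v (convolve (g b) (partial b k)))"
    unfolding L2_inner_def
    by (intro Bochner_Integration.integral_sum L2_inner_convolve(1) test_function_partial k v gL)
  also have "\<dots> = (\<Sum>b\<in>Basis. - L2_inner (g b) (convolve (g b) (\<lambda>z. k (- z))))"
  proof (rule sum.cong[OF refl])
    fix b :: 'a assume b: "b \<in> Basis"
    \<comment> \<open>The derivative of the reflected kernel is minus the reflected derivative; this
      is where the sign of the Dirichlet form arises.\<close>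
    have "convolve v (\<lambda>z. partial b k (- z)) x = - convolve (g b) (\<lambda>z. k (- z)) x" for x
      using convolve_weak_partial[OF g[OF b] test_function_reflect(2)[OF k], of x]
      by (simp add: partial_reflect(2)[OF k] convolve_uminus)
    then have "convolve v (\<lambda>z. partial b k (- z)) = (\<lambda>x. - convolve (g b) (\<lambda>z. k (- z)) x)" by (simp add: fun_eq_iff)
    then show "L2_inner v (convolve (g b) (partial b k)) = - L2_inner (g b) (convolve (g b) (\<lambda>z. k (- z)))"
      unfolding L2_inner_convolve(2)[OF test_function_partial[OF k b] v gL[OF b]]
      by (simp add: L2_inner_def)
  qed
  finally show ?thesis by (simp add: sum_negf)
qed

lemma L2_inner_mollify_tendsto:
  fixes f :: "'a::euclidean_space \<Rightarrow> complex"
  assumes \<psi>: "friedrichs_mollifier \<psi>" and f: "f \<in> L2" and g: "g \<in> L2"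
  shows "((\<lambda>r. L2_inner g (convolve f (scaled \<psi> r))) \<longlongrightarrow> L2_inner g f) (at_right 0)"
proof -
  let ?c = "\<lambda>r. convolve f (scaled \<psi> r)"
  have le: "\<forall>\<^sub>F r in at_right 0. norm (L2_inner g (?c r) - L2_inner g f) \<le> L2_norm g * L2_norm (\<lambda>x. ?c r x - f x)"
    using mollify_tendsto(2)[OF \<psi> f]
  proof eventually_elim
    case (elim r)
    have "L2_inner g (?c r) - L2_inner g f = L2_inner g (\<lambda>x. ?c r x - f x)"
      using elim f g by (simp add: L2_inner_diff_right)
    then show ?case using L2_inner_bound[OF g L2_diff[OF elim f]] by simp
  qed
  have "((\<lambda>r. L2_norm g * L2_norm (\<lambda>x. ?c r x - f x)) \<longlongrightarrow> L2_norm g * 0) (at_right 0)"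
    by (intro tendsto_mult_left mollify_tendsto(1) \<psi> f)
  then have "((\<lambda>r. L2_norm g * L2_norm (\<lambda>x. ?c r x - f x)) \<longlongrightarrow> 0) (at_right 0)" by simp
  from Lim_null_comparison[OF le this]
  have "((\<lambda>r. L2_inner g (?c r) - L2_inner g f) \<longlongrightarrow> 0) (at_right 0)" .
  then show ?thesis by (simp add: LIM_zero_iff)
qed

lemma friedrichs_mollifier_reflect:
  fixes \<psi> :: "'a::euclidean_space \<Rightarrow> real"
  assumes "friedrichs_mollifier \<psi>"
  shows "friedrichs_mollifier (\<lambda>x. \<psi> (- x))"
proof -
  have t: "test_function \<psi>" using assms by (simp add: friedrichs_mollifier_def)
  have [measurable]: "\<psi> \<in> borel_measurable borel" using test_function_borel[OF t] .
  have "(LINT x|lebesgue. \<psi> (- x)) = (LINT x|lebesgue. \<psi> x)"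
    using lborel_integral_affine[of \<psi> "-1" 0] by (simp add: integral_completion)
  then show ?thesis
    using assms test_function_reflect(2)[OF t] by (simp add: friedrichs_mollifier_def)
qed

text \<open>Letting the kernel width tend to 0 in the mollified identity gives the Green formula:
  \<open>L2_inner v L\<close> is minus the sum of the squared norms of the weak partial derivatives.
  The mollifier is auxiliary and absent from the conclusion.\<close>

lemma weak_laplacian_dissipative:
  fixes v :: "'a::euclidean_space \<Rightarrow> complex" and \<psi> :: "'a \<Rightarrow> real"
  assumes \<psi>: "friedrichs_mollifier \<psi>" and L: "has_weak_laplacian v L" and v: "v \<in> H1"
  shows "L2_inner v L \<le> 0"
proof -
  obtain g where g: "\<And>b. b \<in> Basis \<Longrightarrow> has_weak_partial b v (g b)"
    using v unfolding H1_def by (simp add: bchoice_iff) blast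
  have gL: "g b \<in> L2" if "b \<in> Basis" for b using g[OF that] by (simp add: has_weak_partial_def)
  have vL: "v \<in> L2" "L \<in> L2" using L by (auto simp: has_weak_laplacian_def)
  \<comment> \<open>\<psi> need not be even, and passing to the adjoint reflects the kernel; the
    reflected mollifier is again a mollifier, so both sides converge.\<close>
  let ?\<psi> = "\<lambda>x. \<psi> (- x)"
  have 1: "((\<lambda>r. L2_inner v (convolve L (scaled \<psi> r))) \<longlongrightarrow> L2_inner v L) (at_right 0)"
    by (intro L2_inner_mollify_tendsto \<psi> vL)
  have 2: "((\<lambda>r. - (\<Sum>b\<in>Basis. L2_inner (g b) (convolve (g b) (scaled ?\<psi> r)))) \<longlongrightarrow>
      - (\<Sum>b\<in>Basis. L2_inner (g b) (g b))) (at_right 0)"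
    by (intro tendsto_minus tendsto_sum L2_inner_mollify_tendsto friedrichs_mollifier_reflect \<psi> gL)
  have "\<forall>\<^sub>F r :: real in at_right 0. 0 < r" by (simp add: eventually_at_filter)
  then have "\<forall>\<^sub>F r in at_right 0. L2_inner v (convolve L (scaled \<psi> r)) =
      - (\<Sum>b\<in>Basis. L2_inner (g b) (convolve (g b) (scaled ?\<psi> r)))"
  proof eventually_elim
    case (elim r)
    have "(\<lambda>z. scaled \<psi> r (- z)) = scaled ?\<psi> r" by (simp add: scaled_def fun_eq_iff)
    then show ?case using convolved_dirichlet_form[OF scaled_mollifier(1)[OF \<psi> elim] L g] by simp
  qed
  from tendsto_cong[OF this] 1 have
    "((\<lambda>r. - (\<Sum>b\<in>Basis. L2_inner (g b) (convolve (g b) (scaled ?\<psi> r)))) \<longlongrightarrow> L2_inner v L) (at_right 0)"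
    by simp
  from tendsto_unique[OF _ this 2] have "L2_inner v L = - (\<Sum>b\<in>Basis. (L2_norm (g b))\<^sup>2)"
    by (simp add: L2_norm_square)
  also have "\<dots> \<le> 0" by (simp add: sum_nonneg)
  finally show ?thesis .
qed

section \<open>The energy estimate\<close>

lemma has_weak_partial_diff:
  assumes "has_weak_partial b f f'" "has_weak_partial b g g'" "b \<in> Basis"
  shows "has_weak_partial b (\<lambda>x. f x - g x) (\<lambda>x. f' x - g' x)"
proof -
  have L: "f \<in> L2" "f' \<in> L2" "g \<in> L2" "g' \<in> L2" using assms by (auto simp: has_weak_partial_def)
  show ?thesis
    unfolding has_weak_partial_def
  proof (intro conjI L2_diff L allI impI)
    fix \<phi> :: "'a \<Rightarrow> real" assume t: "test_function \<phi>"
    note i = test_function_mult_L2_integrable[OF t] test_function_mult_L2_integrable[OF test_function_partial[OF t assms(3)]]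
    show "(LINT x|lebesgue. partial b \<phi> x *\<^sub>R (f x - g x)) = - (LINT x|lebesgue. \<phi> x *\<^sub>R (f' x - g' x))"
      using assms(1,2) t i L by (simp add: has_weak_partial_def scaleR_diff_right)
  qed
qed

lemma H1_diff:
  assumes "f \<in> H1" "g \<in> H1"
  shows "(\<lambda>x. f x - g x) \<in> H1"
  unfolding H1_def
proof (intro CollectI conjI ballI)
  show "(\<lambda>x. f x - g x) \<in> L2" using assms by (auto simp: H1_def intro: L2_diff)
  fix b :: 'a assume b: "b \<in> Basis"
  then obtain f' g' where "has_weak_partial b f f'" "has_weak_partial b g g'"
    using assms unfolding H1_def by blast
  from has_weak_partial_diff[OF this b] show "\<exists>h. has_weak_partial b (\<lambda>x. f x - g x) h" by blast
qed

lemma has_weak_laplacian_diff: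
  assumes "has_weak_laplacian f f'" "has_weak_laplacian g g'"
  shows "has_weak_laplacian (\<lambda>x. f x - g x) (\<lambda>x. f' x - g' x)"
proof -
  have L: "f \<in> L2" "f' \<in> L2" "g \<in> L2" "g' \<in> L2" using assms by (auto simp: has_weak_laplacian_def)
  show ?thesis
    unfolding has_weak_laplacian_def
  proof (intro conjI L2_diff L allI impI)
    fix \<phi> :: "'a \<Rightarrow> real" assume t: "test_function \<phi>"
    have lap: "integrable lebesgue (\<lambda>x. laplacian \<phi> x *\<^sub>R h x)" if "h \<in> L2" for h :: "'a \<Rightarrow> complex"
      unfolding laplacian_def scaleR_sum_left
      by (intro Bochner_Integration.integrable_sum test_function_mult_L2_integrable test_function_partial t that)
    show "(LINT x|lebesgue. laplacian \<phi> x *\<^sub>R (f x - g x)) = (LINT x|lebesgue. \<phi> x *\<^sub>R (f' x - g' x))"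
      using assms t lap test_function_mult_L2_integrable[OF t] L
      by (simp add: has_weak_laplacian_def scaleR_diff_right)
  qed
qed

text \<open>With w the difference quotient, v s = v t + (s - t) w, and expanding the square gives
  the quotient 2 (v t, w) + (s - t) |w|^2. In the first term w tends to v'; in the second |w| stays
  bounded by d s + |v'|.\<close>

lemma L2_norm_square_has_derivative:
  fixes v :: "real \<Rightarrow> 'a::euclidean_space \<Rightarrow> complex"
  assumes v: "\<And>s. s \<in> S \<Longrightarrow> v s \<in> L2" "t \<in> S" and v': "v' \<in> L2"
    and lim: "((\<lambda>s. L2_norm (\<lambda>x. (v s x - v t x) /\<^sub>R (s - t) - v' x)) \<longlongrightarrow> 0) (at t within S)"
  shows "((\<lambda>s. (L2_norm (v s))\<^sup>2) has_real_derivative 2 * L2_inner (v t) v') (at t within S)"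
proof -
  define d where "d s = L2_norm (\<lambda>x. (v s x - v t x) /\<^sub>R (s - t) - v' x)" for s
  let ?Q = "\<lambda>s. ((L2_norm (v s))\<^sup>2 - (L2_norm (v t))\<^sup>2) / (s - t)"
  let ?B = "\<lambda>s. 2 * (L2_norm (v t) * d s) + \<bar>s - t\<bar> * (d s + L2_norm v')\<^sup>2"
  have vt: "v t \<in> L2" using v by auto
  have bound: "norm (?Q s - 2 * L2_inner (v t) v') \<le> ?B s" if s: "s \<in> S" "s \<noteq> t" for s
  proof -
    define w where "w x = (v s x - v t x) /\<^sub>R (s - t)" for x
    have w: "w \<in> L2" unfolding w_def[abs_def] by (intro L2_scaleR L2_diff v s)
    have wd: "(\<lambda>x. w x - v' x) \<in> L2" by (intro L2_diff w v')
    have vs: "v s = (\<lambda>x. v t x + (s - t) *\<^sub>R w x)" using s(2) by (simp add: w_def fun_eq_iff)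
    have "(L2_norm (v s))\<^sup>2 = (L2_norm (v t))\<^sup>2 + 2 * (s - t) * L2_inner (v t) w + (s - t)\<^sup>2 * (L2_norm w)\<^sup>2"
      unfolding vs using vt w
      by (subst L2_norm_add_square) (auto intro: L2_scaleR simp: L2_inner_scaleR_right L2_norm_scaleR power_mult_distrib)
    then have "?Q s = 2 * L2_inner (v t) w + (s - t) * (L2_norm w)\<^sup>2"
      using s(2) by (simp add: field_simps power2_eq_square)
    then have "?Q s - 2 * L2_inner (v t) v' = 2 * L2_inner (v t) (\<lambda>x. w x - v' x) + (s - t) * (L2_norm w)\<^sup>2"
      using vt w v' by (simp add: L2_inner_diff_right)
    moreover have "\<bar>L2_inner (v t) (\<lambda>x. w x - v' x)\<bar> \<le> L2_norm (v t) * d s"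
      using L2_inner_bound[OF vt wd] by (simp add: d_def w_def[abs_def])
    moreover have "\<bar>(s - t) * (L2_norm w)\<^sup>2\<bar> \<le> \<bar>s - t\<bar> * (d s + L2_norm v')\<^sup>2"
    proof -
      have "L2_norm w \<le> d s + L2_norm v'"
        using L2_norm_triangle[OF wd v'] by (simp add: d_def w_def[abs_def])
      then have "(L2_norm w)\<^sup>2 \<le> (d s + L2_norm v')\<^sup>2" by (rule power_mono) simp
      then show ?thesis by (simp add: abs_mult mult_left_mono)
    qed
    ultimately show ?thesis by simp
  qed
  have "(d \<longlongrightarrow> 0) (at t within S)" using lim by (simp add: d_def[abs_def])
  then have "(?B \<longlongrightarrow> 2 * (L2_norm (v t) * 0) + \<bar>t - t\<bar> * (0 + L2_norm v')\<^sup>2) (at t within S)"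
    by (intro tendsto_intros)
  then have B: "(?B \<longlongrightarrow> 0) (at t within S)" by simp
  have "\<forall>\<^sub>F s in at t within S. norm (?Q s - 2 * L2_inner (v t) v') \<le> ?B s"
    unfolding eventually_at_filter by (rule always_eventually) (use bound in blast)
  from Lim_null_comparison[OF this B]
  show ?thesis by (simp add: has_field_derivative_iff LIM_zero_iff)
qed

lemma has_C1_L2_deriv_diff:
  assumes "has_C1_L2_deriv T u u'" "has_C1_L2_deriv T w w'" "t \<in> {0..T}"
  shows "((\<lambda>s. L2_norm (\<lambda>x. ((w s x - u s x) - (w t x - u t x)) /\<^sub>R (s - t) - (w' t x - u' t x))) \<longlongrightarrow> 0)
    (at t within {0..T})"
proof -
  have L: "u s \<in> L2" "u' s \<in> L2" "w s \<in> L2" "w' s \<in> L2" if "s \<in> {0..T}" for s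
    using assms that by (auto simp: has_C1_L2_deriv_def C_into_def)
  let ?d = "\<lambda>u u' s x. (u s x - u t x) /\<^sub>R (s - t) - u' t x"
  have le: "norm (L2_norm (\<lambda>x. ((w s x - u s x) - (w t x - u t x)) /\<^sub>R (s - t) - (w' t x - u' t x))) \<le>
      L2_norm (?d w w' s) + L2_norm (?d u u' s)" if "s \<in> {0..T}" for s
  proof -
    have dL: "?d u u' s \<in> L2" "?d w w' s \<in> L2"
      by (intro L2_diff L2_scaleR L that assms(3))+
    have "L2_norm (\<lambda>x. ?d w w' s x + (-1) *\<^sub>R ?d u u' s x) \<le> L2_norm (?d w w' s) + L2_norm (\<lambda>x. (-1) *\<^sub>R ?d u u' s x)"
      by (intro L2_norm_triangle L2_scaleR dL)
    also have "L2_norm (\<lambda>x. (-1) *\<^sub>R ?d u u' s x) = L2_norm (?d u u' s)"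
      unfolding L2_norm_scaleR by simp
    finally show ?thesis by (simp add: algebra_simps)
  qed
  have "((\<lambda>s. L2_norm (?d w w' s) + L2_norm (?d u u' s)) \<longlongrightarrow> 0 + 0) (at t within {0..T})"
    using assms by (intro tendsto_add) (auto simp: has_C1_L2_deriv_def)
  then have lim: "((\<lambda>s. L2_norm (?d w w' s) + L2_norm (?d u u' s)) \<longlongrightarrow> 0) (at t within {0..T})" by simp
  show ?thesis
    by (rule Lim_null_comparison[OF _ lim]) (unfold eventually_at_filter, rule always_eventually, use le in blast)
qed

text \<open>In the application p and w are the regularised potential and its solution. Writing p w -
  q u as p (w - u) + (p - q) u leaves one term with a favourable sign and one controlled by
  \<delta>.\<close>

lemma energy_production_le:
  fixes u w :: "'a::euclidean_space \<Rightarrow> complex" and p q :: "'a \<Rightarrow> real" and \<psi> :: "'a \<Rightarrow> real"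
  assumes \<psi>: "friedrichs_mollifier \<psi>"
    and H: "u \<in> H1" "w \<in> H1" and L: "u' \<in> L2" "w' \<in> L2"
    and lap: "has_weak_laplacian u Lu" "has_weak_laplacian w Lw"
    and eq: "AE x in lebesgue. u' x - Lu x + q x *\<^sub>R u x = 0" "AE x in lebesgue. w' x - Lw x + p x *\<^sub>R w x = 0"
    and p: "p \<in> Linf" "AE x in lebesgue. 0 \<le> p x" and q: "q \<in> Linf"
    and \<delta>: "L2_norm (\<lambda>x. (p x - q x) *\<^sub>R u x) \<le> \<delta>"
  shows "L2_inner (\<lambda>x. w x - u x) (\<lambda>x. w' x - u' x) \<le> L2_norm (\<lambda>x. w x - u x) * \<delta>"
proof -
  define v Lv where "v x = w x - u x" and "Lv x = Lw x - Lu x" for x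
  have pm: "p \<in> borel_measurable lebesgue" "q \<in> borel_measurable lebesgue"
    using p q by (auto simp: Linf_def)
  obtain C D where C: "AE x in lebesgue. \<bar>p x\<bar> \<le> C" and D: "AE x in lebesgue. \<bar>q x\<bar> \<le> D"
    using Linf_bounded[OF p(1)] Linf_bounded[OF q] by metis
  have CD: "AE x in lebesgue. \<bar>p x - q x\<bar> \<le> C + D" using C D by eventually_elim auto
  have uw: "u \<in> L2" "w \<in> L2" using H by (auto simp: H1_def)
  have vL: "v \<in> L2" "(\<lambda>x. w' x - u' x) \<in> L2" unfolding v_def[abs_def] by (intro L2_diff L uw)+
  have vH: "v \<in> H1" unfolding v_def[abs_def] by (intro H1_diff H)
  have lv: "has_weak_laplacian v Lv"
    unfolding v_def[abs_def] Lv_def[abs_def] by (intro has_weak_laplacian_diff lap)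
  have LvL: "Lv \<in> L2" using lv by (simp add: has_weak_laplacian_def)
  have pv: "(\<lambda>x. p x *\<^sub>R v x) \<in> L2" by (rule L2_bounded_mult[OF vL(1) pm(1) C])
  have pq: "(\<lambda>x. (p x - q x) *\<^sub>R u x) \<in> L2"
    using pm by (intro L2_bounded_mult[OF uw(1) _ CD]) auto
  have "L2_inner v (\<lambda>x. w' x - u' x) = L2_inner v (\<lambda>x. Lv x - p x *\<^sub>R v x - (p x - q x) *\<^sub>R u x)"
  proof (rule L2_inner_cong_AE)
    show "AE x in lebesgue. w' x - u' x = Lv x - p x *\<^sub>R v x - (p x - q x) *\<^sub>R u x"
      using eq
    proof eventually_elim
      case (elim x)
      then have "u' x = Lu x - q x *\<^sub>R u x" "w' x = Lw x - p x *\<^sub>R w x" by (simp_all add: algebra_simps eq_diff_eq)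
      then show ?case by (simp add: v_def Lv_def algebra_simps)
    qed
    show "(\<lambda>x. Lv x - p x *\<^sub>R v x - (p x - q x) *\<^sub>R u x) \<in> borel_measurable lebesgue"
      by (intro L2_measurable L2_diff LvL pv pq)
  qed (use vL L2_measurable in auto)
  also have "\<dots> = L2_inner v Lv - L2_inner v (\<lambda>x. p x *\<^sub>R v x) - L2_inner v (\<lambda>x. (p x - q x) *\<^sub>R u x)"
    using vL(1) LvL pv pq by (simp add: L2_inner_diff_right L2_diff)
  also have "\<dots> \<le> 0 - 0 + L2_norm v * \<delta>"
  proof -
    have "L2_inner v Lv \<le> 0" by (rule weak_laplacian_dissipative[OF \<psi> lv vH])
    moreover have "0 \<le> L2_inner v (\<lambda>x. p x *\<^sub>R v x)"
      unfolding L2_inner_def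
    proof (rule integral_nonneg_AE)
      show "AE x in lebesgue. 0 \<le> v x \<bullet> (p x *\<^sub>R v x)"
        using p(2) by eventually_elim simp
    qed
    moreover have "\<bar>L2_inner v (\<lambda>x. (p x - q x) *\<^sub>R u x)\<bar> \<le> L2_norm v * \<delta>"
      using L2_inner_bound[OF vL(1) pq] mult_left_mono[OF \<delta> L2_norm_nonneg[of v]] by linarith
    ultimately show ?thesis by linarith
  qed
  finally show ?thesis by (simp add: v_def[abs_def])
qed

lemma energy_estimate:
  fixes u w :: "real \<Rightarrow> 'a::euclidean_space \<Rightarrow> complex" and p q :: "'a \<Rightarrow> real" and \<psi> :: "'a \<Rightarrow> real"
  assumes \<psi>: "friedrichs_mollifier \<psi>"
    and u: "classical_solution T q u0 u" and w: "classical_solution T p w0 w"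
    and p: "p \<in> Linf" "AE x in lebesgue. 0 \<le> p x" and q: "q \<in> Linf"
    and \<delta>: "\<And>s. s \<in> {0..T} \<Longrightarrow> L2_norm (\<lambda>x. (p x - q x) *\<^sub>R u s x) \<le> \<delta>"
    and t: "t \<in> {0..T}"
  shows "(L2_norm (\<lambda>x. w t x - u t x))\<^sup>2 \<le> exp T * ((L2_norm (\<lambda>x. w 0 x - u 0 x))\<^sup>2 + T * \<delta>\<^sup>2)"
proof -
  have H: "u s \<in> H1" "w s \<in> H1" if "s \<in> {0..T}" for s
    using u w that by (auto simp: classical_solution_def C_into_def)
  obtain u' where u': "has_C1_L2_deriv T u u'"
    "\<And>s. s \<in> {0..T} \<Longrightarrow> \<exists>Lu. has_weak_laplacian (u s) Lu \<and>
      (AE x in lebesgue. u' s x - Lu x + q x *\<^sub>R u s x = 0)"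
    using u by (auto simp: classical_solution_def)
  obtain w' where w': "has_C1_L2_deriv T w w'"
    "\<And>s. s \<in> {0..T} \<Longrightarrow> \<exists>Lw. has_weak_laplacian (w s) Lw \<and>
      (AE x in lebesgue. w' s x - Lw x + p x *\<^sub>R w s x = 0)"
    using w by (auto simp: classical_solution_def)
  have L: "u s \<in> L2" "u' s \<in> L2" "w s \<in> L2" "w' s \<in> L2" if "s \<in> {0..T}" for s
    using u'(1) w'(1) that by (auto simp: has_C1_L2_deriv_def C_into_def)
  define v where "v s x = w s x - u s x" for s x
  define N where "N s = (L2_norm (v s))\<^sup>2" for s
  define N' where "N' s = 2 * L2_inner (v s) (\<lambda>x. w' s x - u' s x)" for s
  have vL: "v s \<in> L2" if "s \<in> {0..T}" for s unfolding v_def[abs_def] by (intro L2_diff L that)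
  have deriv: "(N has_real_derivative N' s) (at s within {0..T})" if "s \<in> {0..T}" for s
    unfolding N_def[abs_def] N'_def
    using has_C1_L2_deriv_diff[OF u'(1) w'(1) that] that L
    by (intro L2_norm_square_has_derivative vL L2_diff) (auto simp: v_def)
  have N'_le: "N' s \<le> N s + \<delta>\<^sup>2" if s: "s \<in> {0..T}" for s
  proof -
    obtain Lu Lw where "has_weak_laplacian (u s) Lu" "has_weak_laplacian (w s) Lw"
      "AE x in lebesgue. u' s x - Lu x + q x *\<^sub>R u s x = 0" "AE x in lebesgue. w' s x - Lw x + p x *\<^sub>R w s x = 0"
      using u'(2)[OF s] w'(2)[OF s] by blast
    from energy_production_le[OF \<psi> H(1,2)[OF s] L(2,4)[OF s] this p q \<delta>[OF s]]
    have "N' s \<le> 2 * L2_norm (v s) * \<delta>" by (simp add: N'_def v_def[abs_def])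
    also have "\<dots> \<le> N s + \<delta>\<^sup>2" unfolding N_def by (rule sum_squares_bound)
    finally show ?thesis .
  qed
  \<comment> \<open>Gronwall by the integrating factor exp (- s): the derivative of exp (- s) N s is
    exp (- s) (N' s - N s), at most \<delta>^2, and the mean value theorem replaces integration in
    time.\<close>
  have "\<exists>s\<in>{0..t}. exp (- t) * N t - exp (- 0) * N 0 = (exp (- s) * (N' s - N s)) * (t - 0)"
  proof (rule mvt_very_simple)
    show "0 \<le> t" using t by simp
    fix s assume "0 \<le> s" "s \<le> t"
    then have "s \<in> {0..T}" using t by auto
    then have "(N has_real_derivative N' s) (at s within {0..t})"
      using t by (intro DERIV_subset[OF deriv]) auto
    then have "((\<lambda>s. exp (- s) * N s) has_real_derivative exp (- s) * (N' s - N s)) (at s within {0..t})"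
      by (auto intro!: derivative_eq_intros simp: algebra_simps)
    then show "((\<lambda>s. exp (- s) * N s) has_derivative (\<lambda>h. (exp (- s) * (N' s - N s)) * h)) (at s within {0..t})"
      by (simp add: has_field_derivative_def)
  qed
  then obtain s where s: "s \<in> {0..t}" "exp (- t) * N t = N 0 + exp (- s) * (N' s - N s) * t"
    by auto
  have "exp (- s) * (N' s - N s) \<le> 1 * \<delta>\<^sup>2"
    using s(1) t N'_le[of s] by (intro order_trans[OF mult_left_mono mult_right_mono]) auto
  then have "exp (- s) * (N' s - N s) * t \<le> \<delta>\<^sup>2 * T"
    using t by (intro mult_mono) auto
  then have le: "exp (- t) * N t \<le> N 0 + T * \<delta>\<^sup>2" using s(2) by (simp add: mult.commute)
  have "N t = exp t * (exp (- t) * N t)" by (simp add: exp_minus)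
  also have "\<dots> \<le> exp T * (N 0 + T * \<delta>\<^sup>2)"
    using t le by (intro mult_mono) (auto simp: N_def)
  finally show ?thesis by (simp add: N_def v_def[abs_def])
qed

text \<open>Convergence at each fixed time does not give one kernel width for all times. Finitely
  many times suffice up to an L2 error that multiplication by the uniformly bounded differences
  enlarges by at most 2 C.\<close>

lemma mollify_potential_uniform:
  fixes q :: "'a::euclidean_space \<Rightarrow> real" and u :: "real \<Rightarrow> 'a \<Rightarrow> complex"
  assumes \<psi>: "friedrichs_mollifier \<psi>" and q: "q \<in> Linf"
    and u: "u \<in> C_into T L2 L2_norm" and "0 < \<delta>"
  shows "\<forall>\<^sub>F r in at_right 0. \<forall>s\<in>{0..T}. L2_norm (\<lambda>x. (convolve q (scaled \<psi> r) x - q x) *\<^sub>R u s x) \<le> \<delta>"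
proof -
  have qm: "q \<in> borel_measurable lebesgue" using q by (simp add: Linf_def)
  obtain C where C: "0 \<le> C" "AE x in lebesgue. \<bar>q x\<bar> \<le> C" using Linf_bounded[OF q] .
  have L: "u s \<in> L2" if "s \<in> {0..T}" for s using u that by (simp add: C_into_def)
  \<comment> \<open>Chosen so that 2 C \<eta> \<le> \<delta> / 2; the summand 1 keeps the
    denominator positive when C = 0.\<close>
  define \<eta> where "\<eta> = \<delta> / (2 * (2 * C + 1))"
  have \<eta>: "0 < \<eta>" "2 * C * \<eta> \<le> \<delta> / 2" using C(1) \<open>0 < \<delta>\<close> by (auto simp: \<eta>_def field_simps)
  have "\<exists>d>0. \<forall>s'\<in>{0..T}. dist s' s < d \<longrightarrow> L2_norm (\<lambda>x. u s' x - u s x) < \<eta>" if s: "s \<in> {0..T}" for s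
  proof -
    have "((\<lambda>s'. L2_norm (\<lambda>x. u s' x - u s x)) \<longlongrightarrow> 0) (at s within {0..T})"
      using u s by (simp add: C_into_def)
    from order_tendstoD(2)[OF this \<eta>(1)] obtain d where d: "d > 0"
      "\<And>s'. s' \<in> {0..T} \<Longrightarrow> s' \<noteq> s \<Longrightarrow> dist s' s < d \<Longrightarrow> L2_norm (\<lambda>x. u s' x - u s x) < \<eta>"
      by (auto simp: eventually_at)
    have "L2_norm (\<lambda>x. u s x - u s x) < \<eta>" using \<eta>(1) by (simp add: L2_norm_def)
    with d show ?thesis by metis
  qed
  then obtain d where d: "\<And>s. s \<in> {0..T} \<Longrightarrow> 0 < d s"
    "\<And>s s'. s \<in> {0..T} \<Longrightarrow> s' \<in> {0..T} \<Longrightarrow> dist s' s < d s \<Longrightarrow> L2_norm (\<lambda>x. u s' x - u s x) < \<eta>"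
    by metis
  \<comment> \<open>Compactness is used for the interval of times: the radii d s come from
    continuity of u at s, so the values of u at the finitely many centres form an \<eta>-net of its
    range.\<close>
  obtain D where D: "D \<subseteq> {0..T}" "finite D" "{0..T} \<subseteq> (\<Union>s\<in>D. ball s (d s))"
  proof (rule compactE_image[of "{0..T}" "{0..T}" "\<lambda>s. ball s (d s)"])
    show "{0..T} \<subseteq> (\<Union>s\<in>{0..T}. ball s (d s))" using d(1) by (auto intro!: bexI)
  qed auto
  let ?c = "\<lambda>r x. convolve q (scaled \<psi> r) x - q x"
  have "\<forall>\<^sub>F r in at_right 0. \<forall>s\<in>D. L2_norm (\<lambda>x. ?c r x *\<^sub>R u s x) < \<delta> / 2"
  proof (rule eventually_ball_finite[OF D(2)], rule ballI)
    fix s assume "s \<in> D"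
    then have "u s \<in> L2" using D(1) L by auto
    from mollify_potential_tendsto[OF \<psi> qm C(2,1) this]
    show "\<forall>\<^sub>F r in at_right 0. L2_norm (\<lambda>x. ?c r x *\<^sub>R u s x) < \<delta> / 2"
      using \<open>0 < \<delta>\<close> by (intro order_tendstoD(2)) auto
  qed
  moreover have "\<forall>\<^sub>F r :: real in at_right 0. 0 < r" by (simp add: eventually_at_filter)
  ultimately show ?thesis
  proof eventually_elim
    case (elim r)
    note k = scaled_mollifier[OF \<psi> elim(2)]
    have cm: "?c r \<in> borel_measurable lebesgue"
      using convolve_bounded(2)[OF k qm C(2,1)] qm by auto
    have cb: "AE x in lebesgue. \<bar>?c r x\<bar> \<le> 2 * C"
      using C(2)
    proof eventually_elim
      case (elim x)
      then show ?case using convolve_bounded(1)[OF k qm C(2,1), of x] by simp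
    qed
    show ?case
    proof
      fix s assume s: "s \<in> {0..T}"
      then obtain s0 where s0: "s0 \<in> D" "dist s s0 < d s0" using D(3) by (auto simp: dist_commute)
      then have s0T: "s0 \<in> {0..T}" using D(1) by auto
      have df: "(\<lambda>x. u s x - u s0 x) \<in> L2" by (intro L2_diff L s s0T)
      have "L2_norm (\<lambda>x. ?c r x *\<^sub>R (u s x - u s0 x) + ?c r x *\<^sub>R u s0 x) \<le>
          L2_norm (\<lambda>x. ?c r x *\<^sub>R (u s x - u s0 x)) + L2_norm (\<lambda>x. ?c r x *\<^sub>R u s0 x)"
        by (intro L2_norm_triangle L2_bounded_mult[OF _ cm cb] df L s0T)
      also have "L2_norm (\<lambda>x. ?c r x *\<^sub>R (u s x - u s0 x)) \<le> 2 * C * L2_norm (\<lambda>x. u s x - u s0 x)"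
        using C(1) by (intro L2_norm_bounded_mult_le[OF df cm cb]) simp
      also have "\<dots> \<le> 2 * C * \<eta>"
        using C(1) d(2)[OF s0T s s0(2)] by (intro mult_left_mono) auto
      also have "\<dots> \<le> \<delta> / 2" by (rule \<eta>(2))
      also have "L2_norm (\<lambda>x. ?c r x *\<^sub>R u s0 x) \<le> \<delta> / 2" using elim(1) s0(1) by (auto intro: less_imp_le)
      finally have "L2_norm (\<lambda>x. ?c r x *\<^sub>R (u s x - u s0 x) + ?c r x *\<^sub>R u s0 x) \<le> \<delta>" by simp
      then show "L2_norm (\<lambda>x. ?c r x *\<^sub>R u s x) \<le> \<delta>" by (simp flip: scaleR_add_right)
    qed
  qed
qed

section \<open>Passage to the limit along the regularising scale\<close>

theorem theorem2p8:
  fixes T :: real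
    and \<omega> :: "real \<Rightarrow> real"
    and q :: "'a::euclidean_space \<Rightarrow> real"
    and u0 :: "'a \<Rightarrow> complex"
    and u :: "real \<Rightarrow> 'a \<Rightarrow> complex"
    and q\<epsilon> :: "real \<Rightarrow> 'a \<Rightarrow> real"
    and u0\<epsilon> :: "real \<Rightarrow> 'a \<Rightarrow> complex"
    and u\<epsilon> :: "real \<Rightarrow> real \<Rightarrow> 'a \<Rightarrow> complex"
  assumes "T > 0"
    and "u0 \<in> H1"
    and "q \<in> Linf"
    and "AE x in lebesgue. q x \<ge> 0"
    and "classical_solution T q u0 u"
    and "regularising_scale \<omega>"
    and "very_weak_solution T \<omega> q u0 q\<epsilon> u0\<epsilon> u\<epsilon>"
  shows "\<forall>t\<in>{0..T}. ((\<lambda>\<epsilon>. L2_norm (\<lambda>x. u\<epsilon> \<epsilon> t x - u t x)) \<longlongrightarrow> 0) (at_right 0)"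
proof
  fix t assume t: "t \<in> {0..T}"
  obtain \<psi> where \<psi>: "friedrichs_mollifier \<psi>"
    and fam: "\<And>\<epsilon>. \<epsilon> \<in> {0<..1} \<Longrightarrow> q\<epsilon> \<epsilon> = convolve q (scaled \<psi> (\<omega> \<epsilon>)) \<and> u0\<epsilon> \<epsilon> = convolve u0 (scaled \<psi> (\<omega> \<epsilon>))"
    using assms(7) unfolding very_weak_solution_def regularising_families_def by blast
  have sol: "q\<epsilon> \<epsilon> \<in> Linf" "AE x in lebesgue. 0 \<le> q\<epsilon> \<epsilon> x" "u0\<epsilon> \<epsilon> \<in> H1"
    "classical_solution T (q\<epsilon> \<epsilon>) (u0\<epsilon> \<epsilon>) (u\<epsilon> \<epsilon>)" if "\<epsilon> \<in> {0<..1}" for \<epsilon>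
    using assms(7) that by (auto simp: very_weak_solution_def moderate_def)
  have ev01: "\<forall>\<^sub>F \<epsilon> :: real in at_right 0. \<epsilon> \<in> {0<..1}"
    using eventually_at_right_real[of 0 "1::real"] by (auto elim: eventually_mono)
  \<comment> \<open>The mollification limits are taken in the kernel width r > 0. Substituting r =
    \<omega> \<epsilon> requires that \<omega> \<epsilon> approach 0 through positive
    values.\<close>
  have \<omega>: "filterlim \<omega> (at_right 0) (at_right 0)"
    unfolding filterlim_at
  proof
    show "\<forall>\<^sub>F \<epsilon> in at_right 0. \<omega> \<epsilon> \<in> {0<..} \<and> \<omega> \<epsilon> \<noteq> 0"
      using ev01
    proof eventually_elim
      case (elim \<epsilon>)
      then have "0 < \<omega> \<epsilon>" using assms(6) by (simp add: regularising_scale_def)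
      then show ?case by simp
    qed
    show "(\<omega> \<longlongrightarrow> 0) (at_right 0)" using assms(6) by (simp add: regularising_scale_def)
  qed
  have u0L: "u0 \<in> L2" using assms(2) by (simp add: H1_def)
  have uC: "u \<in> C_into T L2 L2_norm"
    using assms(5) by (auto simp: classical_solution_def has_C1_L2_deriv_def)
  have initial: "L2_norm (\<lambda>x. u\<epsilon> \<epsilon> 0 x - u 0 x) = L2_norm (\<lambda>x. convolve u0 (scaled \<psi> (\<omega> \<epsilon>)) x - u0 x)"
    if \<epsilon>: "\<epsilon> \<in> {0<..1}" for \<epsilon>
  proof (rule L2_norm_cong_AE)
    have "AE x in lebesgue. u\<epsilon> \<epsilon> 0 x = u0\<epsilon> \<epsilon> x" "AE x in lebesgue. u 0 x = u0 x"
      using sol(4)[OF \<epsilon>] assms(5) by (auto simp: classical_solution_def)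
    then show "AE x in lebesgue. u\<epsilon> \<epsilon> 0 x - u 0 x = convolve u0 (scaled \<psi> (\<omega> \<epsilon>)) x - u0 x"
      by eventually_elim (simp add: fam[OF \<epsilon>])
    have "u\<epsilon> \<epsilon> 0 \<in> L2" "u 0 \<in> L2" "u0\<epsilon> \<epsilon> \<in> L2"
      using sol(3,4)[OF \<epsilon>] assms(1,5) by (auto simp: classical_solution_def C_into_def H1_def)
    then show "(\<lambda>x. u\<epsilon> \<epsilon> 0 x - u 0 x) \<in> borel_measurable lebesgue"
      "(\<lambda>x. convolve u0 (scaled \<psi> (\<omega> \<epsilon>)) x - u0 x) \<in> borel_measurable lebesgue"
      using u0L fam[OF \<epsilon>] by (auto intro!: L2_measurable L2_diff)
  qed
  show "((\<lambda>\<epsilon>. L2_norm (\<lambda>x. u\<epsilon> \<epsilon> t x - u t x)) \<longlongrightarrow> 0) (at_right 0)"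
  proof (rule tendstoI)
    fix e :: real assume e: "0 < e"
    \<comment> \<open>K is chosen so that the right-hand side of the energy estimate equals e^2 / 2
      when the initial error and the remainder are both \<delta>; the factor 2 in K gives the strict
      inequality at the end.\<close>
    define K where "K = 2 * exp T * (1 + T)"
    define \<delta> where "\<delta> = e / sqrt K"
    have K: "0 < K" using assms(1) by (simp add: K_def)
    have "exp T * (\<delta>\<^sup>2 + T * \<delta>\<^sup>2) = K / 2 * \<delta>\<^sup>2" by (simp add: K_def algebra_simps)
    also have "\<dots> = e\<^sup>2 / 2" using K by (simp add: \<delta>_def power_divide)
    finally have \<delta>: "0 < \<delta>" "exp T * (\<delta>\<^sup>2 + T * \<delta>\<^sup>2) = e\<^sup>2 / 2" using K e by (simp_all add: \<delta>_def)
    have "\<forall>\<^sub>F \<epsilon> in at_right 0. \<forall>s\<in>{0..T}.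
        L2_norm (\<lambda>x. (convolve q (scaled \<psi> (\<omega> \<epsilon>)) x - q x) *\<^sub>R u s x) \<le> \<delta>"
      using eventually_compose_filterlim[OF mollify_potential_uniform[OF \<psi> assms(3) uC \<delta>(1)] \<omega>] .
    moreover have "\<forall>\<^sub>F \<epsilon> in at_right 0. L2_norm (\<lambda>x. convolve u0 (scaled \<psi> (\<omega> \<epsilon>)) x - u0 x) < \<delta>"
      using filterlim_compose[OF mollify_tendsto(1)[OF \<psi> u0L] \<omega>] \<delta>(1) by (intro order_tendstoD(2)) auto
    ultimately show "\<forall>\<^sub>F \<epsilon> in at_right 0. dist (L2_norm (\<lambda>x. u\<epsilon> \<epsilon> t x - u t x)) 0 < e"
      using ev01
    proof eventually_elim
      case (elim \<epsilon>)
      have "(L2_norm (\<lambda>x. u\<epsilon> \<epsilon> t x - u t x))\<^sup>2 \<le>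
          exp T * ((L2_norm (\<lambda>x. u\<epsilon> \<epsilon> 0 x - u 0 x))\<^sup>2 + T * \<delta>\<^sup>2)"
        using elim fam[OF elim(3)]
        by (intro energy_estimate[OF \<psi> assms(5) sol(4)[OF elim(3)] sol(1,2)[OF elim(3)] assms(3) _ t]) auto
      also have "\<dots> \<le> exp T * (\<delta>\<^sup>2 + T * \<delta>\<^sup>2)"
        using elim(2) by (intro mult_left_mono add_right_mono) (auto simp: initial[OF elim(3)] intro!: power_mono)
      also have "\<dots> < e\<^sup>2" using e by (simp add: \<delta>(2))
      finally have "L2_norm (\<lambda>x. u\<epsilon> \<epsilon> t x - u t x) < e"
        using e by (intro power2_less_imp_less[of _ e]) auto
      then show ?case by simp
    qed
  qed
qed

end
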